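(* Given $I\subseteq\{1,\ldots,n\}$, set $\xi_I=\sum_{i\in I}H_i$. The element $\xi_I+\delta_I(n)H_n$ is the unique $I$-canonical element of $Sp(n)$, where $\delta_I(j)=1$ if $j\in I$ and $\delta_I(j)=0$ if $j\notin I$. Moreover, for all $k\le n$, $$r_{\rho_k}(\xi_I+\delta_I(n)H_n)=2|I|+2|I\cap\{2,\ldots,n\}|+\ldots+2|I\cap\{k,\ldots,n\}|.$$
   Context: General setting. Let $G$ be a compact connected Lie group with Lie algebra $\mathfrak g$, $\mathfrak t\subset\mathfrak g$ a maximal torus (maximal abelian subalgebra), $\alpha_1,\ldots,\alpha_n\in\sqrt{-1}\,\mathfrak t^*$ the positive simple roots for a chosen set of positive roots $\Delta^+$, and $H_1,\ldots,H_n\in\mathfrak t$ the dual basis: $\alpha_i(H_j)=\sqrt{-1}\,\delta_{ij}$. Put $\mathfrak I(G)=\{\xi\in\mathfrak t:\exp_G(2\pi\xi)=e\}$ and $\mathfrak I'(G)=\{\xi\in\mathfrak I(G): \alpha(\xi)/\sqrt{-1}\ge 0 \text{ for all }\alpha\in\Delta^+\}$. For $\xi\in\mathfrak I'(G)$ let $\mathfrak g^\xi_j$ ($j\in\mathbb Z$) be the $\sqrt{-1}\,j$-eigenspace of $\mathrm{ad}\,\xi$ on $\mathfrak g^{\mathbb C}$ and $\mathfrak p_i^\xi=\bigoplus_{j\le i}\mathfrak g_j^\xi$. Define a partial order on $\mathfrak I'(G)$ by: $\xi\preceq\xi'$ iff $\mathfrak p^\xi_i\subseteq\mathfrak p^{\xi'}_i$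 for all $i\ge 0$ (writing $\xi=\sum n_iH_i$, $\xi'=\sum n_i'H_i$, this is equivalent to $n_i'\le n_i$ for all $i$). For $I\subseteq\{1,\ldots,n\}$ let $\mathfrak C_I=\{\sum_i n_iH_i : n_i\ge 0,\ n_j=0 \text{ iff } j\notin I\}$. An $I$-canonical element of $G$ is a maximal element of $(\mathfrak I'(G)\cap\mathfrak C_I,\preceq)$. Uniton number. If $\rho$ is an irreducible representation of $\mathfrak g^{\mathbb C}$ with highest weight $\omega^*$ and lowest weight $\varpi^*$, then $r_\rho(\xi):=\frac{1}{\sqrt{-1}}\big(\omega^*(\xi)-\varpi^*(\xi)\big)$. The case $(C_n)$. $G=Sp(n)=\{X\in U(2n): XJ=JX\}$, where $J:\mathbb C^{2n}\to\mathbb C^{2n}$ is the anti-linear map representing left multiplication by the quaternion $j$. With respect to an orthonormal basis $e_1,\ldots,e_{2n}$ of $\mathbb C^{2n}$ with $e_{n+i}=Je_i$, $E_i$ is the diagonal matrix with $E_ie_i=\sqrt{-1}e_i$, $E_ie_{n+i}=-\sqrt{-1}e_{n+i}$ and zero on the other basis vectors. $\mathfrak t=\{\sum a_iE_i:a_i\in\mathbb R\}$, $L_i(E_j)=\sqrt{-1}\,\delta_{ij}$. The positive roots are $\Delta^+=\{L_i+L_j\}_{i\le j}\cup\{L_i-L_j\}_{i<j}$, with simple roots $\alpha_i=L_i-L_{i+1}$ for $1\le i\le n-1$ and $\alpha_n=2L_n$, so that $H_i=E_1+\ldots+E_i$ for $i\le n-1$ and $H_n=\frac12(E_1+\ldots+E_n)$.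 The fundamental weights are $\omega_i=L_1+\ldots+L_i$ ($1\le i\le n$), and $\rho_k$ is the irreducible representation with highest weight $\omega_k$. *)

theory Defs
  imports Complex_Main "Jordan_Normal_Form.Schur_Decomposition"
begin

section \<open>Matrix groups and their Lie algebras\<close>

text \<open>Matrices are zero-based, while all mathematical indices (basis vectors, roots, weights,
  \<open>I\<close>) are one-based.\<close>

text \<open>Addition of matrices has no neutral element independent of the dimension, so that
  \<open>sum\<close> is not available on \<open>mat\<close>; finite sums are taken entrywise.\<close>

definition mat_sum :: "nat \<Rightarrow> ('b \<Rightarrow> complex mat) \<Rightarrow> 'b set \<Rightarrow> complex mat" where
  "mat_sum m F S = mat m m (\<lambda>rc. \<Sum>s\<in>S. F s $$ rc)"

definition mat_exp :: "complex mat \<Rightarrow> complex mat" where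
  "mat_exp A = mat (dim_row A) (dim_row A) (\<lambda>rc. \<Sum>k. (A ^\<^sub>m k) $$ rc / fact k)"

definition bracket :: "complex mat \<Rightarrow> complex mat \<Rightarrow> complex mat" where
  "bracket A B = A * B - B * A"

definition lie_algebra :: "nat \<Rightarrow> complex mat set \<Rightarrow> complex mat set" where
  "lie_algebra m G = {X \<in> carrier_mat m m. \<forall>s::real. mat_exp (complex_of_real s \<cdot>\<^sub>m X) \<in> G}"

text \<open>For a subalgebra \<open>g\<close> of skew-Hermitian matrices, \<open>g\<close> and \<open>\<i> g\<close> meet in \<open>0\<close>, so the abstract
  complexification is realised inside the complex matrices.\<close>

definition complexification :: "complex mat set \<Rightarrow> complex mat set" where
  "complexification g = {X + \<i> \<cdot>\<^sub>m Y | X Y. X \<in> g \<and> Y \<in> g}"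

definition ad_eigenspace :: "complex mat set \<Rightarrow> complex mat \<Rightarrow> int \<Rightarrow> complex mat set" where
  "ad_eigenspace gC \<xi> j = {X \<in> gC. bracket \<xi> X = (\<i> * of_int j) \<cdot>\<^sub>m X}"

text \<open>The sum of the (automatically independent) eigenspaces with index at most \<open>i\<close>.\<close>

definition parab :: "nat \<Rightarrow> complex mat set \<Rightarrow> complex mat \<Rightarrow> int \<Rightarrow> complex mat set" where
  "parab m gC \<xi> i =
     {mat_sum m X S | X S. finite S \<and> S \<subseteq> {..i} \<and> (\<forall>j\<in>S. X j \<in> ad_eigenspace gC \<xi> j)}"

definition preceq :: "nat \<Rightarrow> complex mat set \<Rightarrow> complex mat \<Rightarrow> complex mat \<Rightarrow> bool" where
  "preceq m gC \<xi> \<xi>' \<longleftrightarrow> (\<forall>i\<ge>0. parab m gC \<xi> i \<subseteq> parab m gC \<xi>' i)"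

section \<open>The group \<open>Sp(n)\<close>\<close>

text \<open>The antilinear map with \<open>J e\<^sub>i = e\<^sub>n\<^sub>+\<^sub>i\<close> and \<open>J e\<^sub>n\<^sub>+\<^sub>i = - e\<^sub>i\<close>.\<close>

definition J_map :: "nat \<Rightarrow> complex vec \<Rightarrow> complex vec" where
  "J_map n v = vec (2 * n) (\<lambda>r. if r < n then - cnj (v $ (n + r)) else cnj (v $ (r - n)))"

definition Sp :: "nat \<Rightarrow> complex mat set" where
  "Sp n = {X \<in> carrier_mat (2 * n) (2 * n).
     mat_adjoint X * X = 1\<^sub>m (2 * n) \<and> X * mat_adjoint X = 1\<^sub>m (2 * n) \<and>
     (\<forall>v \<in> carrier_vec (2 * n). X *\<^sub>v J_map n v = J_map n (X *\<^sub>v v))}"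

definition spC :: "nat \<Rightarrow> complex mat set" where
  "spC n = complexification (lie_algebra (2 * n) (Sp n))"

definition E :: "nat \<Rightarrow> nat \<Rightarrow> complex mat" where
  "E n i = mat (2 * n) (2 * n) (\<lambda>(r, c).
     if r = c \<and> r = i - 1 then \<i> else if r = c \<and> r = n + i - 1 then - \<i> else 0)"

definition torus :: "nat \<Rightarrow> complex mat set" where
  "torus n = {mat_sum (2 * n) (\<lambda>i. complex_of_real (a i) \<cdot>\<^sub>m E n i) {1..n} | a. True}"

text \<open>Linear functionals on the torus are functions on matrices of which only the values on the
  torus matter. Since \<open>L\<^sub>i(E\<^sub>j) = \<i> \<delta>\<^sub>i\<^sub>j\<close>, the functional \<open>L\<^sub>i\<close> reads off a diagonal entry.\<close>

definition L :: "nat \<Rightarrow> complex mat \<Rightarrow> complex" where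
  "L i \<xi> = \<xi> $$ (i - 1, i - 1)"

definition pos_roots :: "nat \<Rightarrow> (complex mat \<Rightarrow> complex) set" where
  "pos_roots n =
     {\<lambda>\<xi>. L i \<xi> + L j \<xi> | i j. 1 \<le> i \<and> i \<le> j \<and> j \<le> n} \<union>
     {\<lambda>\<xi>. L i \<xi> - L j \<xi> | i j. 1 \<le> i \<and> i < j \<and> j \<le> n}"

definition simple_root :: "nat \<Rightarrow> nat \<Rightarrow> complex mat \<Rightarrow> complex" where
  "simple_root n i = (if i < n then (\<lambda>\<xi>. L i \<xi> - L (i + 1) \<xi>) else (\<lambda>\<xi>. 2 * L n \<xi>))"

definition H :: "nat \<Rightarrow> nat \<Rightarrow> complex mat" where
  "H n i = (if i < n then mat_sum (2 * n) (E n) {1..i} else (1/2) \<cdot>\<^sub>m mat_sum (2 * n) (E n) {1..n})"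

lemma L_E: "L i (E n j) = (if i = j then \<i> else 0)" if "i \<in> {1..n}" "j \<in> {1..n}"
  using that by (auto simp: L_def E_def)

lemma L_H: "L i (H n j) = (if j < n then if i \<le> j then \<i> else 0 else \<i> / 2)"
  if "i \<in> {1..n}" "j \<in> {1..n}"
proof -
  have i: "i - 1 < 2 * n"
    using \<open>i \<in> {1..n}\<close> by auto
  have "L i (mat_sum (2 * n) (E n) {1..l}) = (if i \<le> l then \<i> else 0)" if "l \<le> n" for l
  proof -
    have "L i (mat_sum (2 * n) (E n) {1..l}) = (\<Sum>s\<in>{1..l}. L i (E n s))"
      using i by (simp add: L_def mat_sum_def)
    also have "\<dots> = (\<Sum>s\<in>{1..l}. if i = s then \<i> else 0)"
      using \<open>i \<in> {1..n}\<close> \<open>l \<le> n\<close> by (intro sum.cong) (auto simp: L_E)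
    finally show ?thesis using \<open>i \<in> {1..n}\<close> by simp
  qed
  moreover have "L i (c \<cdot>\<^sub>m mat_sum (2 * n) (E n) {1..n}) = c * L i (mat_sum (2 * n) (E n) {1..n})" for c
    using i by (auto simp: L_def mat_sum_def)
  ultimately show ?thesis using that by (simp add: H_def)
qed

text \<open>\<open>H\<^sub>1, \<dots>, H\<^sub>n\<close> is indeed dual to the simple roots.\<close>

lemma simple_root_H:
  assumes "i \<in> {1..n}" "j \<in> {1..n}"
  shows "simple_root n i (H n j) = (if i = j then \<i> else 0)"
  using assms by (auto simp: simple_root_def L_H)

section \<open>Canonical elements\<close>

definition int_lattice :: "nat \<Rightarrow> complex mat set" where
  "int_lattice n = {\<xi> \<in> torus n. mat_exp (complex_of_real (2 * pi) \<cdot>\<^sub>m \<xi>) = 1\<^sub>m (2 * n)}"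

text \<open>Roots are purely imaginary on the torus, so the real part below loses nothing.\<close>

definition pos_lattice :: "nat \<Rightarrow> complex mat set" where
  "pos_lattice n = {\<xi> \<in> int_lattice n. \<forall>\<alpha>\<in>pos_roots n. Re (\<alpha> \<xi> / \<i>) \<ge> 0}"

definition cone :: "nat \<Rightarrow> nat set \<Rightarrow> complex mat set" where
  "cone n I = {mat_sum (2 * n) (\<lambda>i. complex_of_real (a i) \<cdot>\<^sub>m H n i) {1..n} | a.
     \<forall>j\<in>{1..n}. a j \<ge> 0 \<and> (a j = 0 \<longleftrightarrow> j \<notin> I)}"

definition canonical :: "nat \<Rightarrow> nat set \<Rightarrow> complex mat \<Rightarrow> bool" where
  "canonical n I \<xi> \<longleftrightarrow> \<xi> \<in> pos_lattice n \<inter> cone n I \<and>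
     (\<forall>\<xi>' \<in> pos_lattice n \<inter> cone n I. preceq (2 * n) (spC n) \<xi> \<xi>' \<longrightarrow> \<xi>' = \<xi>)"

definition xi_sum :: "nat \<Rightarrow> nat set \<Rightarrow> complex mat" where
  "xi_sum n I = mat_sum (2 * n) (H n) I"

definition delta :: "nat set \<Rightarrow> nat \<Rightarrow> complex" where
  "delta I j = (if j \<in> I then 1 else 0)"

section \<open>Representations and weights\<close>

text \<open>Complex representations of a complex matrix Lie algebra on \<open>\<complex>\<^sup>d\<close>; values of \<open>\<rho>\<close> outside the
  Lie algebra are irrelevant.\<close>

definition lie_rep :: "complex mat set \<Rightarrow> nat \<Rightarrow> (complex mat \<Rightarrow> complex mat) \<Rightarrow> bool" where
  "lie_rep gC d \<rho> \<longleftrightarrow>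
     (\<forall>X\<in>gC. \<rho> X \<in> carrier_mat d d) \<and>
     (\<forall>X\<in>gC. \<forall>Y\<in>gC. \<rho> (X + Y) = \<rho> X + \<rho> Y) \<and>
     (\<forall>X\<in>gC. \<forall>c. \<rho> (c \<cdot>\<^sub>m X) = c \<cdot>\<^sub>m \<rho> X) \<and>
     (\<forall>X\<in>gC. \<forall>Y\<in>gC. \<rho> (bracket X Y) = bracket (\<rho> X) (\<rho> Y))"

definition irreducible_rep :: "complex mat set \<Rightarrow> nat \<Rightarrow> (complex mat \<Rightarrow> complex mat) \<Rightarrow> bool" where
  "irreducible_rep gC d \<rho> \<longleftrightarrow> lie_rep gC d \<rho> \<and> d > 0 \<and>
     (\<forall>W. VectorSpace.subspace class_ring W (module_vec TYPE(complex) d) \<and>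
          (\<forall>X\<in>gC. \<forall>w\<in>W. \<rho> X *\<^sub>v w \<in> W) \<longrightarrow> W = {0\<^sub>v d} \<or> W = carrier_vec d)"

text \<open>Weights are made extensional, so that each is determined by its values on the torus.\<close>

definition is_weight :: "nat \<Rightarrow> nat \<Rightarrow> (complex mat \<Rightarrow> complex mat) \<Rightarrow> (complex mat \<Rightarrow> complex) \<Rightarrow> bool" where
  "is_weight n d \<rho> \<omega> \<longleftrightarrow> \<omega> \<in> extensional (torus n) \<and>
     (\<exists>v \<in> carrier_vec d. v \<noteq> 0\<^sub>v d \<and> (\<forall>\<xi>\<in>torus n. \<rho> \<xi> *\<^sub>v v = \<omega> \<xi> \<cdot>\<^sub>v v))"

text \<open>The usual partial order: the difference is a combination of simple roots with natural
  coefficients.\<close>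

definition weight_le :: "nat \<Rightarrow> (complex mat \<Rightarrow> complex) \<Rightarrow> (complex mat \<Rightarrow> complex) \<Rightarrow> bool" where
  "weight_le n \<mu> \<omega> \<longleftrightarrow>
     (\<exists>c::nat \<Rightarrow> nat. \<forall>\<xi>\<in>torus n. \<omega> \<xi> - \<mu> \<xi> = (\<Sum>i=1..n. of_nat (c i) * simple_root n i \<xi>))"

definition is_highest_weight :: "nat \<Rightarrow> nat \<Rightarrow> (complex mat \<Rightarrow> complex mat) \<Rightarrow> (complex mat \<Rightarrow> complex) \<Rightarrow> bool" where
  "is_highest_weight n d \<rho> \<omega> \<longleftrightarrow>
     is_weight n d \<rho> \<omega> \<and> (\<forall>\<mu>. is_weight n d \<rho> \<mu> \<longrightarrow> weight_le n \<mu> \<omega>)"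

definition is_lowest_weight :: "nat \<Rightarrow> nat \<Rightarrow> (complex mat \<Rightarrow> complex mat) \<Rightarrow> (complex mat \<Rightarrow> complex) \<Rightarrow> bool" where
  "is_lowest_weight n d \<rho> \<omega> \<longleftrightarrow>
     is_weight n d \<rho> \<omega> \<and> (\<forall>\<mu>. is_weight n d \<rho> \<mu> \<longrightarrow> weight_le n \<omega> \<mu>)"

definition r_num :: "nat \<Rightarrow> nat \<Rightarrow> (complex mat \<Rightarrow> complex mat) \<Rightarrow> complex mat \<Rightarrow> complex" where
  "r_num n d \<rho> \<xi> =
     1 / \<i> * ((THE \<omega>. is_highest_weight n d \<rho> \<omega>) \<xi> - (THE \<omega>. is_lowest_weight n d \<rho> \<omega>) \<xi>)"

definition fundamental_weight :: "nat \<Rightarrow> nat \<Rightarrow> complex mat \<Rightarrow> complex" where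
  "fundamental_weight n k = restrict (\<lambda>\<xi>. \<Sum>i=1..k. L i \<xi>) (torus n)"

end

theory Submission
  imports Defs
begin

text \<open>The group and its Lie algebra enter through the matrix exponential, so its basic calculus
  comes first. The addition formula for commuting matrices and the derivative at \<open>0\<close> turn the
  definition of \<open>spC n\<close> into linear conditions on the entries (\<open>spC_iff\<close>); the exponential of
  diagonal matrices turns the lattice condition \<open>exp (2 \<pi> \<xi>) = 1\<close> into integrality of the coordinates with respect to the \<open>E\<^sub>i\<close>.

  An element \<open>\<xi>\<close> of the torus is diagonal, so \<open>ad \<xi>\<close> multiplies the entry \<open>(r, c)\<close> by the
  difference of two diagonal entries. Hence a matrix of \<open>spC n\<close> lies in the \<open>i\<close>-th parabolic piece
  exactly when its nonzero entries sit at positions where this difference, divided by \<open>\<i>\<close>, is at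
  most \<open>i\<close> (\<open>parab_torus_elem_iff\<close>). Every root is a nonnegative or a nonpositive combination of
  simple roots, while a root vector of a simple root detects one coordinate of \<open>\<xi>\<close>; therefore the
  order on \<open>\<Sum> n\<^sub>j H\<^sub>j\<close> is the reversed coordinatewise order (\<open>preceq_H_comb_iff\<close>). The lattice
  condition makes the \<open>n\<^sub>j\<close> integers with \<open>n\<^sub>n\<close> even, because \<open>H\<^sub>n\<close> carries the factor
  \<open>1/2\<close>. On the cone of \<open>I\<close> the least admissible coordinates are thus \<open>1\<close> for \<open>j < n\<close> in \<open>I\<close>
  and \<open>2\<close> for \<open>j = n\<close> in \<open>I\<close>. The corresponding element is a greatest element for the order, hence
  the only maximal one (\<open>canonical_iff\<close>).

  For the uniton number it has to be shown that the lowest weight is the negative of the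
  highest weight. The matrix \<open>\<Omega>\<close> of \<open>J\<close> belongs to \<open>spC n\<close>, and conjugation by
  \<open>exp ((\<pi> / 2) \<Omega>)\<close> is \<open>- 1\<close> on the torus, the longest Weyl group element. In a representation
  \<open>\<rho>\<close> the operator \<open>exp ((\<pi> / 2) \<rho> \<Omega>)\<close> accordingly anticommutes with the torus, so that it maps
  weight vectors to weight vectors of the opposite weight (\<open>lie_rep_torus_anticommutes\<close>,
  \<open>is_weight_uminus\<close>). Then \<open>r\<close> is twice the value of \<open>\<omega>\<^sub>k\<close> divided by \<open>\<i>\<close>, and \<open>L\<^sub>i\<close> of the canonical
  element is \<open>\<i>\<close> times the number of elements of \<open>I\<close> that are at least \<open>i\<close>.\<close>

section \<open>The matrix exponential\<close>

lemma index_mult_mat_sum: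
  assumes "A \<in> carrier_mat m k" "B \<in> carrier_mat k l" "r < m" "c < l"
  shows "(A * B) $$ (r, c) = (\<Sum>s<k. A $$ (r, s) * B $$ (s, c))"
  using assms by (simp add: scalar_prod_def lessThan_atLeast0)

lemma pow_mat_Suc_left:
  fixes A :: "'a::semiring_1 mat"
  assumes "A \<in> carrier_mat m m"
  shows "A ^\<^sub>m Suc k = A * A ^\<^sub>m k"
proof (induction k)
  case 0
  show ?case using assms by simp
next
  case (Suc k)
  have "A ^\<^sub>m Suc (Suc k) = (A * A ^\<^sub>m k) * A"
    using Suc by simp
  also have "\<dots> = A * A ^\<^sub>m Suc k"
    using assms by (simp add: assoc_mult_mat[of _ m m _ m _ m])
  finally show ?case .
qed

lemma pow_mat_smult_entry:
  fixes A :: "complex mat"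
  assumes "A \<in> carrier_mat m m" "r < m" "c < m"
  shows "((z \<cdot>\<^sub>m A) ^\<^sub>m k) $$ (r, c) = z ^ k * (A ^\<^sub>m k) $$ (r, c)"
  using assms(2,3)
proof (induction k arbitrary: r c)
  case 0
  then show ?case using assms(1) by simp
next
  case (Suc k)
  then show ?case using assms(1)
    by (simp add: index_mult_mat_sum[of _ m m _ m] sum_distrib_left mult_ac del: index_mult_mat)
qed

text \<open>The entries of the powers grow at most geometrically, which gives absolute convergence of the
  entrywise exponential series and so permits Cauchy products.\<close>

lemma pow_mat_entry_bound:
  fixes A :: "complex mat"
  assumes "A \<in> carrier_mat m m"
  obtains K where "K \<ge> 0" "\<And>k r c. r < m \<Longrightarrow> c < m \<Longrightarrow> norm ((A ^\<^sub>m k) $$ (r, c)) \<le> K ^ k"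
proof
  define K where "K = (\<Sum>c<m. \<Sum>s<m. norm (A $$ (s, c)))"
  show "K \<ge> 0" unfolding K_def by (intro sum_nonneg) auto
  have col: "(\<Sum>s<m. norm (A $$ (s, c))) \<le> K" if "c < m" for c
    unfolding K_def using that
    by (intro member_le_sum[where f = "\<lambda>c. \<Sum>s<m. norm (A $$ (s, c))"] sum_nonneg) auto
  show "norm ((A ^\<^sub>m k) $$ (r, c)) \<le> K ^ k" if "r < m" "c < m" for k r c
    using that
  proof (induction k arbitrary: r c)
    case 0
    then show ?case using assms by simp
  next
    case (Suc k)
    have "norm ((A ^\<^sub>m Suc k) $$ (r, c)) = norm (\<Sum>s<m. (A ^\<^sub>m k) $$ (r, s) * A $$ (s, c))"
      using Suc.prems assms by (simp add: index_mult_mat_sum[of _ m m _ m] del: index_mult_mat)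
    also have "\<dots> \<le> (\<Sum>s<m. norm ((A ^\<^sub>m k) $$ (r, s)) * norm (A $$ (s, c)))"
      by (rule sum_norm_le) (simp add: norm_mult)
    also have "\<dots> \<le> (\<Sum>s<m. K ^ k * norm (A $$ (s, c)))"
      using Suc by (intro sum_mono mult_right_mono) auto
    also have "\<dots> = K ^ k * (\<Sum>s<m. norm (A $$ (s, c)))"
      by (simp add: sum_distrib_left)
    also have "\<dots> \<le> K ^ k * K"
      using col Suc.prems \<open>K \<ge> 0\<close> by (intro mult_left_mono) auto
    finally show ?case by (simp add: mult.commute)
  qed
qed

lemma mat_exp_entry_summable:
  fixes A :: "complex mat"
  assumes "A \<in> carrier_mat m m" "r < m" "c < m"
  shows "summable (\<lambda>k. norm ((A ^\<^sub>m k) $$ (r, c) / fact k))"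
proof -
  obtain K where K: "K \<ge> 0" "\<And>k r c. r < m \<Longrightarrow> c < m \<Longrightarrow> norm ((A ^\<^sub>m k) $$ (r, c)) \<le> K ^ k"
    by (rule pow_mat_entry_bound[OF assms(1)]) blast
  have "summable (\<lambda>k. K ^ k / fact k)"
    using summable_exp[of K] by (simp add: field_simps)
  then show ?thesis
    by (rule summable_comparison_test'[where N = 0])
      (use K assms in \<open>auto simp: norm_divide intro: divide_right_mono\<close>)
qed

lemma mat_exp_carrier [simp]: "A \<in> carrier_mat m m \<Longrightarrow> mat_exp A \<in> carrier_mat m m"
  by (auto simp: mat_exp_def)

lemma mat_exp_entry_sums:
  assumes "A \<in> carrier_mat m m" "r < m" "c < m"
  shows "(\<lambda>k. (A ^\<^sub>m k) $$ (r, c) / fact k) sums (mat_exp A $$ (r, c))"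
  using summable_norm_cancel[OF mat_exp_entry_summable[OF assms]] assms
  by (auto simp: mat_exp_def summable_sums)

text \<open>Pascal's rule as it occurs in the induction step of the binomial theorem, with \<open>x i j\<close> in the
  place of \<open>a\<^sup>i b\<^sup>j\<close>.\<close>

lemma binomial_sum_Suc:
  fixes x :: "nat \<Rightarrow> nat \<Rightarrow> 'a::comm_semiring_1"
  shows "(\<Sum>i\<le>k. of_nat (k choose i) * (x (Suc i) (k - i) + x i (Suc k - i))) =
    (\<Sum>i\<le>Suc k. of_nat (Suc k choose i) * x i (Suc k - i))"
proof -
  have "(\<Sum>i\<le>Suc k. of_nat (Suc k choose i) * x i (Suc k - i)) =
      x 0 (Suc k) + (\<Sum>i\<le>k. (of_nat (k choose i) + of_nat (k choose Suc i)) * x (Suc i) (k - i))"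
    by (simp only: sum.atMost_Suc_shift) simp
  also have "\<dots> = (\<Sum>i\<le>k. of_nat (k choose i) * x (Suc i) (k - i)) +
      (x 0 (Suc k) + (\<Sum>i\<le>k. of_nat (k choose Suc i) * x (Suc i) (k - i)))"
    by (simp add: algebra_simps sum.distrib)
  also have "x 0 (Suc k) + (\<Sum>i\<le>k. of_nat (k choose Suc i) * x (Suc i) (k - i)) =
      (\<Sum>i\<le>Suc k. of_nat (k choose i) * x i (Suc k - i))"
    by (simp only: sum.atMost_Suc_shift) simp
  also have "\<dots> = (\<Sum>i\<le>k. of_nat (k choose i) * x i (Suc k - i))"
    by (simp add: binomial_eq_0)
  finally show ?thesis
    by (simp add: algebra_simps sum.distrib)
qed

lemma pow_mat_commute:
  fixes A B :: "'a::semiring_1 mat"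
  assumes "A \<in> carrier_mat m m" "B \<in> carrier_mat m m" "M \<in> carrier_mat m m" "A * M = M * B"
  shows "A ^\<^sub>m k * M = M * B ^\<^sub>m k"
proof (induction k)
  case 0
  show ?case using assms by simp
next
  case (Suc k)
  have "A ^\<^sub>m Suc k * M = A ^\<^sub>m k * (A * M)"
    using assms by (simp add: assoc_mult_mat[of _ m m _ m _ m])
  also have "\<dots> = (A ^\<^sub>m k * M) * B"
    using assms by (simp add: assoc_mult_mat[of _ m m _ m _ m])
  also have "\<dots> = M * B ^\<^sub>m Suc k"
    using assms by (simp add: Suc assoc_mult_mat[of _ m m _ m _ m])
  finally show ?case .
qed

lemma pow_mat_add_commuting_entry:
  fixes A B :: "complex mat"
  assumes "A \<in> carrier_mat m m" "B \<in> carrier_mat m m" "A * B = B * A" "r < m" "c < m"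
  shows "((A + B) ^\<^sub>m k) $$ (r, c) =
    (\<Sum>i\<le>k. of_nat (k choose i) * (A ^\<^sub>m i * B ^\<^sub>m (k - i)) $$ (r, c))"
  using assms(4)
proof (induction k arbitrary: r)
  case 0
  then show ?case using assms by simp
next
  case (Suc k)
  have A: "(\<Sum>s<m. A $$ (r, s) * (A ^\<^sub>m i * B ^\<^sub>m j) $$ (s, c)) = (A ^\<^sub>m Suc i * B ^\<^sub>m j) $$ (r, c)" for i j
  proof -
    have "A ^\<^sub>m Suc i * B ^\<^sub>m j = A * (A ^\<^sub>m i * B ^\<^sub>m j)"
      using assms by (simp add: pow_mat_Suc_left[of _ m] assoc_mult_mat[of _ m m _ m _ m] del: pow_mat.simps)
    then show ?thesis
      using assms Suc.prems index_mult_mat_sum[of A m m "A ^\<^sub>m i * B ^\<^sub>m j" m r c] mult_carrier_mat[of "A ^\<^sub>m i" m m "B ^\<^sub>m j" m]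
      by (simp del: index_mult_mat)
  qed
  have B: "(\<Sum>s<m. B $$ (r, s) * (A ^\<^sub>m i * B ^\<^sub>m j) $$ (s, c)) = (A ^\<^sub>m i * B ^\<^sub>m Suc j) $$ (r, c)" for i j
  proof -
    have "A ^\<^sub>m i * B ^\<^sub>m Suc j = (A ^\<^sub>m i * B) * B ^\<^sub>m j"
      using assms by (simp add: pow_mat_Suc_left[of _ m] assoc_mult_mat[of _ m m _ m _ m] del: pow_mat.simps)
    also have "\<dots> = B * (A ^\<^sub>m i * B ^\<^sub>m j)"
      using assms by (simp add: pow_mat_commute[of A m A] assoc_mult_mat[of _ m m _ m _ m])
    finally show ?thesis
      using assms Suc.prems index_mult_mat_sum[of B m m "A ^\<^sub>m i * B ^\<^sub>m j" m r c] mult_carrier_mat[of "A ^\<^sub>m i" m m "B ^\<^sub>m j" m]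
      by (simp del: index_mult_mat)
  qed
  have "((A + B) ^\<^sub>m Suc k) $$ (r, c) = (\<Sum>s<m. (A $$ (r, s) + B $$ (r, s)) * ((A + B) ^\<^sub>m k) $$ (s, c))"
    using assms Suc.prems
    by (simp add: pow_mat_Suc_left[of _ m] index_mult_mat_sum[of _ m m _ m] del: pow_mat.simps index_mult_mat)
  also have "\<dots> = (\<Sum>s<m. \<Sum>i\<le>k. of_nat (k choose i) *
      (A $$ (r, s) * (A ^\<^sub>m i * B ^\<^sub>m (k - i)) $$ (s, c) + B $$ (r, s) * (A ^\<^sub>m i * B ^\<^sub>m (k - i)) $$ (s, c)))"
    using Suc.IH by (intro sum.cong refl) (auto simp: sum_distrib_left algebra_simps)
  also have "\<dots> = (\<Sum>i\<le>k. of_nat (k choose i) *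
      ((\<Sum>s<m. A $$ (r, s) * (A ^\<^sub>m i * B ^\<^sub>m (k - i)) $$ (s, c)) +
       (\<Sum>s<m. B $$ (r, s) * (A ^\<^sub>m i * B ^\<^sub>m (k - i)) $$ (s, c))))"
    by (subst sum.swap) (simp only: sum_distrib_left sum.distrib distrib_left)
  also have "\<dots> = (\<Sum>i\<le>k. of_nat (k choose i) *
      ((A ^\<^sub>m Suc i * B ^\<^sub>m (k - i)) $$ (r, c) + (A ^\<^sub>m i * B ^\<^sub>m (Suc k - i)) $$ (r, c)))"
    unfolding A B by (intro sum.cong refl) (simp add: Suc_diff_le)
  also have "\<dots> = (\<Sum>i\<le>Suc k. of_nat (Suc k choose i) * (A ^\<^sub>m i * B ^\<^sub>m (Suc k - i)) $$ (r, c))"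
    by (rule binomial_sum_Suc[where x = "\<lambda>i j. (A ^\<^sub>m i * B ^\<^sub>m j) $$ (r, c)"])
  finally show ?case .
qed

text \<open>By the binomial theorem each entry of the exponential series of \<open>A + B\<close> is a finite sum of
  Cauchy products of entries of the two series.\<close>

lemma mat_exp_add_commuting:
  assumes "A \<in> carrier_mat m m" "B \<in> carrier_mat m m" "A * B = B * A"
  shows "mat_exp (A + B) = mat_exp A * mat_exp B"
proof (rule eq_matI)
  fix r c assume "r < dim_row (mat_exp A * mat_exp B)" "c < dim_col (mat_exp A * mat_exp B)"
  then have rc: "r < m" "c < m"
    using mat_exp_carrier[OF assms(1)] mat_exp_carrier[OF assms(2)] by auto
  have AB: "A + B \<in> carrier_mat m m"
    using assms by simp
  let ?a = "\<lambda>s k. (A ^\<^sub>m k) $$ (r, s) / fact k" and ?b = "\<lambda>s k. (B ^\<^sub>m k) $$ (s, c) / fact k"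
  have "(\<lambda>k. \<Sum>s<m. \<Sum>i\<le>k. ?a s i * ?b s (k - i)) sums
      (\<Sum>s<m. mat_exp A $$ (r, s) * mat_exp B $$ (s, c))"
  proof (intro sums_sum)
    fix s assume "s \<in> {..<m}"
    then have s: "s < m" by simp
    show "(\<lambda>k. \<Sum>i\<le>k. ?a s i * ?b s (k - i)) sums (mat_exp A $$ (r, s) * mat_exp B $$ (s, c))"
      using Cauchy_product_sums[OF mat_exp_entry_summable[OF assms(1) rc(1) s]
          mat_exp_entry_summable[OF assms(2) s rc(2)]]
        sums_unique[OF mat_exp_entry_sums[OF assms(1) rc(1) s]]
        sums_unique[OF mat_exp_entry_sums[OF assms(2) s rc(2)]] by simp
  qed
  also have "(\<lambda>k. \<Sum>s<m. \<Sum>i\<le>k. ?a s i * ?b s (k - i)) = (\<lambda>k. ((A + B) ^\<^sub>m k) $$ (r, c) / fact k)"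
  proof
    fix k
    have "((A + B) ^\<^sub>m k) $$ (r, c) / fact k =
        (\<Sum>i\<le>k. of_nat (k choose i) / fact k * (\<Sum>s<m. (A ^\<^sub>m i) $$ (r, s) * (B ^\<^sub>m (k - i)) $$ (s, c)))"
      unfolding pow_mat_add_commuting_entry[OF assms rc] using assms rc
      by (simp add: sum_divide_distrib index_mult_mat_sum[of _ m m _ m] del: index_mult_mat)
    also have "\<dots> = (\<Sum>i\<le>k. \<Sum>s<m. ?a s i * ?b s (k - i))"
      by (intro sum.cong refl) (simp add: sum_distrib_left binomial_fact field_simps)
    also have "\<dots> = (\<Sum>s<m. \<Sum>i\<le>k. ?a s i * ?b s (k - i))"
      by (rule sum.swap)
    finally show "(\<Sum>s<m. \<Sum>i\<le>k. ?a s i * ?b s (k - i)) = ((A + B) ^\<^sub>m k) $$ (r, c) / fact k"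
      by simp
  qed
  finally have "mat_exp (A + B) $$ (r, c) = (\<Sum>s<m. mat_exp A $$ (r, s) * mat_exp B $$ (s, c))"
    using sums_unique2 mat_exp_entry_sums[OF AB rc] by blast
  then show "mat_exp (A + B) $$ (r, c) = (mat_exp A * mat_exp B) $$ (r, c)"
    using assms rc by (simp add: index_mult_mat_sum[of _ m m _ m] del: index_mult_mat)
qed (use assms in \<open>auto simp: mat_exp_def\<close>)

lemma mat_exp_diag:
  "mat_exp (mat m m (\<lambda>(r, c). if r = c then d r else 0)) = mat m m (\<lambda>(r, c). if r = c then exp (d r) else 0)"
proof (rule eq_matI)
  let ?D = "mat m m (\<lambda>(r, c). if r = c then d r else 0)"
  fix r c assume "r < dim_row (mat m m (\<lambda>(r, c). if r = c then exp (d r) else 0))"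
    "c < dim_col (mat m m (\<lambda>(r, c). if r = c then exp (d r) else 0))"
  then have rc: "r < m" "c < m" by auto
  have pow: "(?D ^\<^sub>m k) $$ (r, c) = (if r = c then d r ^ k else 0)" for k
    using rc
  proof (induction k arbitrary: c)
    case 0
    then show ?case by simp
  next
    case (Suc k)
    have "(?D ^\<^sub>m Suc k) $$ (r, c) = (\<Sum>s<m. (?D ^\<^sub>m k) $$ (r, s) * ?D $$ (s, c))"
      using Suc.prems by (simp add: index_mult_mat_sum[of _ m m _ m] del: index_mult_mat)
    also have "\<dots> = (\<Sum>s<m. if s = r then d r ^ k * ?D $$ (r, c) else 0)"
      using Suc by (intro sum.cong) auto
    finally show ?case using Suc.prems by simp
  qed
  have "(\<lambda>k. (?D ^\<^sub>m k) $$ (r, c) / fact k) sums (if r = c then exp (d r) else 0)"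
    using exp_converges[of "d r"] unfolding pow by (auto simp: scaleR_conv_of_real field_simps)
  moreover have "(\<lambda>k. (?D ^\<^sub>m k) $$ (r, c) / fact k) sums mat_exp ?D $$ (r, c)"
    using rc by (intro mat_exp_entry_sums) auto
  ultimately show "mat_exp ?D $$ (r, c) = mat m m (\<lambda>(r, c). if r = c then exp (d r) else 0) $$ (r, c)"
    using rc sums_unique2 by fastforce
qed (auto simp: mat_exp_def)

lemma mat_exp_scalar: "mat_exp (z \<cdot>\<^sub>m 1\<^sub>m m) = exp z \<cdot>\<^sub>m 1\<^sub>m m"
proof -
  have "w \<cdot>\<^sub>m 1\<^sub>m m = mat m m (\<lambda>(r, c). if r = c then w else 0)" for w :: complex
    by (rule eq_matI) auto
  then show ?thesis using mat_exp_diag[of m "\<lambda>_. z"] by simp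
qed

lemma mat_exp_uminus_inverse:
  assumes "A \<in> carrier_mat m m"
  shows "mat_exp A * mat_exp (- A) = 1\<^sub>m m" "mat_exp (- A) * mat_exp A = 1\<^sub>m m"
proof -
  have *: "mat_exp B * mat_exp (- B) = 1\<^sub>m m" if B: "B \<in> carrier_mat m m" for B
  proof -
    have "B * (- B) = (- B) * B"
      using B by (intro eq_matI) (auto simp: index_mult_mat_sum[of _ m m _ m] simp del: index_mult_mat)
    then have "mat_exp (B + - B) = mat_exp B * mat_exp (- B)"
      using B by (intro mat_exp_add_commuting[of _ m]) auto
    moreover have "B + - B = 0 \<cdot>\<^sub>m 1\<^sub>m m"
      using B by (intro eq_matI) auto
    ultimately have "mat_exp B * mat_exp (- B) = 1 \<cdot>\<^sub>m 1\<^sub>m m"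
      using mat_exp_scalar[of 0 m] by simp
    moreover have "1 \<cdot>\<^sub>m 1\<^sub>m m = (1\<^sub>m m :: complex mat)"
      by (intro eq_matI) auto
    ultimately show ?thesis by simp
  qed
  show "mat_exp A * mat_exp (- A) = 1\<^sub>m m" using *[OF assms] .
  show "mat_exp (- A) * mat_exp A = 1\<^sub>m m"
    using *[of "- A"] assms by (simp add: uminus_uminus_mat[of A])
qed

lemma mat_exp_intertwine:
  assumes A: "A \<in> carrier_mat m m" and B: "B \<in> carrier_mat m m" and M: "M \<in> carrier_mat m m"
    and AM: "A * M = M * B"
  shows "mat_exp A * M = M * mat_exp B"
proof (rule eq_matI)
  fix r c assume "r < dim_row (M * mat_exp B)" "c < dim_col (M * mat_exp B)"
  then have rc: "r < m" "c < m" using M mat_exp_carrier[OF B] by auto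
  have "(\<lambda>k. \<Sum>s<m. (A ^\<^sub>m k) $$ (r, s) / fact k * M $$ (s, c)) sums (\<Sum>s<m. mat_exp A $$ (r, s) * M $$ (s, c))"
    using A rc by (intro sums_sum sums_mult2 mat_exp_entry_sums) auto
  moreover have "(\<lambda>k. \<Sum>s<m. M $$ (r, s) * ((B ^\<^sub>m k) $$ (s, c) / fact k)) sums (\<Sum>s<m. M $$ (r, s) * mat_exp B $$ (s, c))"
    using B rc by (intro sums_sum sums_mult mat_exp_entry_sums) auto
  moreover have "(\<Sum>s<m. (A ^\<^sub>m k) $$ (r, s) / fact k * M $$ (s, c)) = (\<Sum>s<m. M $$ (r, s) * ((B ^\<^sub>m k) $$ (s, c) / fact k))" for k
  proof -
    have "(A ^\<^sub>m k * M) $$ (r, c) / fact k = (M * B ^\<^sub>m k) $$ (r, c) / fact k"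
      using pow_mat_commute[OF A B M AM] by simp
    then show ?thesis using A B M rc
      by (simp add: index_mult_mat_sum[of _ m m _ m] sum_divide_distrib field_simps del: index_mult_mat)
  qed
  ultimately have "(\<Sum>s<m. mat_exp A $$ (r, s) * M $$ (s, c)) = (\<Sum>s<m. M $$ (r, s) * mat_exp B $$ (s, c))"
    using sums_unique2 by simp
  then show "(mat_exp A * M) $$ (r, c) = (M * mat_exp B) $$ (r, c)"
    using A B M rc by (simp add: index_mult_mat_sum[of _ m m _ m] del: index_mult_mat)
qed (use A B M in \<open>auto simp: mat_exp_def\<close>)

text \<open>The hypothesis says \<open>A M = M (A + z)\<close>, a relation that passes to powers and hence to the
  exponential. This is \<open>Ad (exp A) = exp (ad A)\<close> on an eigenvector of \<open>ad A\<close>.\<close>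

lemma mat_exp_ad_eigenvector:
  assumes A: "A \<in> carrier_mat m m" and M: "M \<in> carrier_mat m m" and br: "bracket A M = z \<cdot>\<^sub>m M"
  shows "mat_exp A * M = exp z \<cdot>\<^sub>m (M * mat_exp A)"
proof -
  have zI: "z \<cdot>\<^sub>m 1\<^sub>m m \<in> carrier_mat m m" by simp
  have "A * M = M * (A + z \<cdot>\<^sub>m 1\<^sub>m m)"
  proof -
    have "A * M = M * A + bracket A M"
      unfolding bracket_def using A M by (intro eq_matI) auto
    also have "\<dots> = M * (A + z \<cdot>\<^sub>m 1\<^sub>m m)"
      using A M unfolding br
      by (subst mult_add_distrib_mat[OF M A zI])
        (metis M mult_smult_distrib one_carrier_mat right_mult_one_mat)
    finally show ?thesis .
  qed
  then have "mat_exp A * M = M * mat_exp (A + z \<cdot>\<^sub>m 1\<^sub>m m)"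
    using A M by (intro mat_exp_intertwine[of _ m]) auto
  also have "mat_exp (A + z \<cdot>\<^sub>m 1\<^sub>m m) = mat_exp A * (exp z \<cdot>\<^sub>m 1\<^sub>m m)"
  proof -
    have "A * (z \<cdot>\<^sub>m 1\<^sub>m m) = z \<cdot>\<^sub>m 1\<^sub>m m * A"
      using A mult_smult_distrib[OF A one_carrier_mat, of z] mult_smult_assoc_mat[OF one_carrier_mat A, of z]
      by simp
    then show ?thesis
      using mat_exp_add_commuting[OF A zI] by (simp add: mat_exp_scalar)
  qed
  also have "mat_exp A * (exp z \<cdot>\<^sub>m 1\<^sub>m m) = exp z \<cdot>\<^sub>m mat_exp A"
    using mult_smult_distrib[OF mat_exp_carrier[OF A] one_carrier_mat, of "exp z"] mat_exp_carrier[OF A] by simp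
  also have "M * (exp z \<cdot>\<^sub>m mat_exp A) = exp z \<cdot>\<^sub>m (M * mat_exp A)"
    using mult_smult_distrib[OF M mat_exp_carrier[OF A]] .
  finally show ?thesis .
qed

text \<open>Relations that hold along a one-parameter group become linear relations for its generator when
  they are differentiated at \<open>0\<close>.\<close>

lemma mat_exp_entry_deriv_0:
  assumes X: "X \<in> carrier_mat m m" and rc: "r < m" "c < m"
  shows "((\<lambda>s::real. mat_exp (complex_of_real s \<cdot>\<^sub>m X) $$ (r, c)) has_vector_derivative X $$ (r, c)) (at 0)"
proof -
  let ?a = "\<lambda>k. (X ^\<^sub>m k) $$ (r, c) / fact k"
  have eq: "mat_exp (z \<cdot>\<^sub>m X) $$ (r, c) = (\<Sum>k. ?a k * z ^ k)" and sm: "summable (\<lambda>k. ?a k * z ^ k)" for z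
  proof -
    have zX: "z \<cdot>\<^sub>m X \<in> carrier_mat m m" using X by simp
    have "(\<lambda>k. ?a k * z ^ k) sums mat_exp (z \<cdot>\<^sub>m X) $$ (r, c)"
      using mat_exp_entry_sums[OF zX rc] by (simp add: pow_mat_smult_entry[OF X rc] mult.commute)
    then show "mat_exp (z \<cdot>\<^sub>m X) $$ (r, c) = (\<Sum>k. ?a k * z ^ k)" "summable (\<lambda>k. ?a k * z ^ k)"
      by (auto simp: sums_iff)
  qed
  have "((\<lambda>z. \<Sum>k. ?a k * z ^ k) has_field_derivative (\<Sum>k. diffs ?a k * 0 ^ k)) (at 0)"
    by (rule termdiffs_strong[OF sm[of 1]]) simp
  also have "(\<Sum>k. diffs ?a k * 0 ^ k) = X $$ (r, c)"
    using X by (simp add: diffs_def)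
  finally have "((\<lambda>z. mat_exp (z \<cdot>\<^sub>m X) $$ (r, c)) has_field_derivative X $$ (r, c)) (at (complex_of_real 0))"
    by (simp add: eq)
  from has_vector_derivative_real_field[OF this] show ?thesis by simp
qed

section \<open>The complexified Lie algebra of \<open>Sp(n)\<close>\<close>

text \<open>For zero-based indices, \<open>J\<close> maps the basis vector number \<open>c\<close> to \<open>jsgn n r\<close> times the one
  with number \<open>r = jconj n c\<close>.\<close>

definition jconj :: "nat \<Rightarrow> nat \<Rightarrow> nat" where
  "jconj n r = (if r < n then n + r else r - n)"

definition jsgn :: "nat \<Rightarrow> nat \<Rightarrow> complex" where
  "jsgn n r = (if r < n then - 1 else 1)"

lemma jconj_less: "r < 2 * n \<Longrightarrow> jconj n r < 2 * n"
  by (auto simp: jconj_def)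

lemma jconj_jconj: "r < 2 * n \<Longrightarrow> jconj n (jconj n r) = r"
  by (auto simp: jconj_def)

lemma jsgn_jconj: "r < 2 * n \<Longrightarrow> jsgn n (jconj n r) = - jsgn n r"
  by (auto simp: jconj_def jsgn_def)

lemma jsgn_square: "jsgn n r * jsgn n r = 1" "jsgn n r * (jsgn n r * z) = z"
  by (auto simp: jsgn_def)

lemma cnj_jsgn: "cnj (jsgn n r) = jsgn n r"
  by (auto simp: jsgn_def)

lemmas jconj_simps = jconj_less jconj_jconj jsgn_jconj jsgn_square cnj_jsgn

lemma sum_jconj: "(\<Sum>s<2 * n. f (jconj n s)) = (\<Sum>s<2 * n. f s)"
proof -
  have "bij_betw (jconj n) {..<2 * n} {..<2 * n}"
    by (rule bij_betw_byWitness[where f' = "jconj n"]) (auto simp: jconj_simps)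
  then show ?thesis by (rule sum.reindex_bij_betw)
qed

text \<open>The condition \<open>X J = J X\<close> on the entries of \<open>X\<close>; in this form it passes to products and limits,
  and can be differentiated.\<close>

definition quaternionic :: "nat \<Rightarrow> complex mat \<Rightarrow> bool" where
  "quaternionic n X \<longleftrightarrow>
     (\<forall>r<2 * n. \<forall>c<2 * n. X $$ (r, c) = jsgn n r * jsgn n c * cnj (X $$ (jconj n r, jconj n c)))"

lemma index_mult_mat_vec_sum:
  assumes "A \<in> carrier_mat m k" "v \<in> carrier_vec k" "r < m"
  shows "(A *\<^sub>v v) $ r = (\<Sum>s<k. A $$ (r, s) * v $ s)"
  using assms by (simp add: scalar_prod_def lessThan_atLeast0)

lemma J_map_carrier: "J_map n v \<in> carrier_vec (2 * n)"
  by (simp add: J_map_def)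

lemma J_map_index: "r < 2 * n \<Longrightarrow> J_map n v $ r = jsgn n r * cnj (v $ jconj n r)"
  by (simp add: J_map_def jsgn_def jconj_def)

lemma commutes_J_map_iff_quaternionic:
  assumes X: "X \<in> carrier_mat (2 * n) (2 * n)"
  shows "(\<forall>v\<in>carrier_vec (2 * n). X *\<^sub>v J_map n v = J_map n (X *\<^sub>v v)) \<longleftrightarrow> quaternionic n X"
proof
  assume comm: "\<forall>v\<in>carrier_vec (2 * n). X *\<^sub>v J_map n v = J_map n (X *\<^sub>v v)"
  show "quaternionic n X"
    unfolding quaternionic_def
  proof (intro allI impI)
    fix r c assume rc: "r < 2 * n" "c < 2 * n"
    let ?v = "unit_vec (2 * n) (jconj n c) :: complex vec"
    have "(X *\<^sub>v J_map n ?v) $ r = (\<Sum>s<2 * n. X $$ (r, s) * J_map n ?v $ s)"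
      using X rc by (intro index_mult_mat_vec_sum J_map_carrier) auto
    also have "\<dots> = (\<Sum>s<2 * n. if s = c then X $$ (r, c) * jsgn n c else 0)"
    proof (intro sum.cong refl)
      fix s assume s: "s \<in> {..<2 * n}"
      then have "jconj n s = jconj n c \<longleftrightarrow> s = c"
        using rc by (metis jconj_jconj lessThan_iff)
      then show "X $$ (r, s) * J_map n ?v $ s = (if s = c then X $$ (r, c) * jsgn n c else 0)"
        using s rc by (auto simp: J_map_index unit_vec_def jconj_simps)
    qed
    finally have L: "(X *\<^sub>v J_map n ?v) $ r = X $$ (r, c) * jsgn n c"
      using rc by simp
    have "(X *\<^sub>v ?v) $ jconj n r = (\<Sum>s<2 * n. X $$ (jconj n r, s) * ?v $ s)"
      using X rc by (intro index_mult_mat_vec_sum) (auto simp: jconj_simps)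
    also have "\<dots> = (\<Sum>s<2 * n. if s = jconj n c then X $$ (jconj n r, jconj n c) else 0)"
      using rc by (intro sum.cong refl) (auto simp: unit_vec_def jconj_simps)
    finally have "(X *\<^sub>v ?v) $ jconj n r = X $$ (jconj n r, jconj n c)"
      using rc by (simp add: jconj_simps)
    then have "J_map n (X *\<^sub>v ?v) $ r = jsgn n r * cnj (X $$ (jconj n r, jconj n c))"
      using rc by (simp add: J_map_index)
    moreover have "X *\<^sub>v J_map n ?v = J_map n (X *\<^sub>v ?v)"
      using comm by simp
    ultimately have "X $$ (r, c) * jsgn n c = jsgn n r * cnj (X $$ (jconj n r, jconj n c))"
      using L by simp
    then have "X $$ (r, c) * jsgn n c * jsgn n c = jsgn n r * cnj (X $$ (jconj n r, jconj n c)) * jsgn n c"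
      by simp
    then show "X $$ (r, c) = jsgn n r * jsgn n c * cnj (X $$ (jconj n r, jconj n c))"
      by (simp add: jsgn_square mult_ac)
  qed
next
  assume Q: "quaternionic n X"
  show "\<forall>v\<in>carrier_vec (2 * n). X *\<^sub>v J_map n v = J_map n (X *\<^sub>v v)"
  proof (intro ballI eq_vecI)
    fix v :: "complex vec" and r assume v: "v \<in> carrier_vec (2 * n)" and "r < dim_vec (J_map n (X *\<^sub>v v))"
    then have r: "r < 2 * n" by (simp add: J_map_def)
    have "(X *\<^sub>v J_map n v) $ r = (\<Sum>s<2 * n. X $$ (r, s) * J_map n v $ s)"
      using X r by (intro index_mult_mat_vec_sum J_map_carrier) auto
    also have "\<dots> = (\<Sum>s<2 * n. jsgn n r * cnj (X $$ (jconj n r, jconj n s) * v $ jconj n s))"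
    proof (intro sum.cong refl)
      fix s assume s: "s \<in> {..<2 * n}"
      then have "X $$ (r, s) = jsgn n r * jsgn n s * cnj (X $$ (jconj n r, jconj n s))"
        using Q r unfolding quaternionic_def by simp
      then show "X $$ (r, s) * J_map n v $ s = jsgn n r * cnj (X $$ (jconj n r, jconj n s) * v $ jconj n s)"
        using s by (simp add: J_map_index jsgn_square mult_ac)
    qed
    also have "\<dots> = (\<Sum>s<2 * n. jsgn n r * cnj (X $$ (jconj n r, s) * v $ s))"
      by (rule sum_jconj)
    also have "\<dots> = jsgn n r * cnj ((X *\<^sub>v v) $ jconj n r)"
      using X v r
      by (simp add: index_mult_mat_vec_sum[of _ "2 * n" "2 * n"] jconj_simps sum_distrib_left del: index_mult_mat_vec)
    finally show "(X *\<^sub>v J_map n v) $ r = J_map n (X *\<^sub>v v) $ r"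
      using r by (simp add: J_map_index)
  qed (use X in \<open>auto simp: J_map_def\<close>)
qed

lemma quaternionic_mult:
  assumes "A \<in> carrier_mat (2 * n) (2 * n)" "B \<in> carrier_mat (2 * n) (2 * n)"
    "quaternionic n A" "quaternionic n B"
  shows "quaternionic n (A * B)"
  unfolding quaternionic_def
proof (intro allI impI)
  fix r c assume rc: "r < 2 * n" "c < 2 * n"
  have "(A * B) $$ (r, c) = (\<Sum>s<2 * n. A $$ (r, s) * B $$ (s, c))"
    using assms rc by (intro index_mult_mat_sum) auto
  also have "\<dots> = (\<Sum>s<2 * n. jsgn n r * jsgn n c *
      cnj (A $$ (jconj n r, jconj n s) * B $$ (jconj n s, jconj n c)))"
  proof (intro sum.cong refl)
    fix s assume "s \<in> {..<2 * n}"
    then have "A $$ (r, s) = jsgn n r * jsgn n s * cnj (A $$ (jconj n r, jconj n s))"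
      "B $$ (s, c) = jsgn n s * jsgn n c * cnj (B $$ (jconj n s, jconj n c))"
      using assms(3,4) rc unfolding quaternionic_def by simp_all
    then show "A $$ (r, s) * B $$ (s, c) = jsgn n r * jsgn n c *
        cnj (A $$ (jconj n r, jconj n s) * B $$ (jconj n s, jconj n c))"
      by (simp add: jsgn_square mult_ac)
  qed
  also have "\<dots> = (\<Sum>s<2 * n. jsgn n r * jsgn n c * cnj (A $$ (jconj n r, s) * B $$ (s, jconj n c)))"
    by (rule sum_jconj)
  also have "\<dots> = jsgn n r * jsgn n c * cnj ((A * B) $$ (jconj n r, jconj n c))"
    using assms rc
    by (simp add: index_mult_mat_sum[of _ "2 * n" "2 * n"] jconj_simps sum_distrib_left del: index_mult_mat)
  finally show "(A * B) $$ (r, c) = jsgn n r * jsgn n c * cnj ((A * B) $$ (jconj n r, jconj n c))" .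
qed

lemma quaternionic_one: "quaternionic n (1\<^sub>m (2 * n))"
  unfolding quaternionic_def
proof (intro allI impI)
  fix r c assume rc: "r < 2 * n" "c < 2 * n"
  then have "jconj n r = jconj n c \<longleftrightarrow> r = c"
    by (metis jconj_jconj)
  then show "1\<^sub>m (2 * n) $$ (r, c) = jsgn n r * jsgn n c * cnj (1\<^sub>m (2 * n) $$ (jconj n r, jconj n c))"
    using rc by (simp add: jconj_simps)
qed

lemma quaternionic_mat_exp:
  assumes X: "X \<in> carrier_mat (2 * n) (2 * n)" and Q: "quaternionic n X"
  shows "quaternionic n (mat_exp X)"
  unfolding quaternionic_def
proof (intro allI impI)
  fix r c assume rc: "r < 2 * n" "c < 2 * n"
  have Qk: "quaternionic n (X ^\<^sub>m k)" for k
    using X Q by (induction k) (auto simp: quaternionic_one intro: quaternionic_mult)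
  have "(\<lambda>k. jsgn n r * jsgn n c * cnj ((X ^\<^sub>m k) $$ (jconj n r, jconj n c) / fact k)) sums
      (jsgn n r * jsgn n c * cnj (mat_exp X $$ (jconj n r, jconj n c)))"
    using X rc by (intro sums_mult) (simp only: sums_cnj mat_exp_entry_sums jconj_less)
  moreover have "jsgn n r * jsgn n c * cnj ((X ^\<^sub>m k) $$ (jconj n r, jconj n c) / fact k) =
      (X ^\<^sub>m k) $$ (r, c) / fact k" for k
  proof -
    have "(X ^\<^sub>m k) $$ (r, c) = jsgn n r * jsgn n c * cnj ((X ^\<^sub>m k) $$ (jconj n r, jconj n c))"
      using Qk rc unfolding quaternionic_def by blast
    then show ?thesis by simp
  qed
  ultimately show "mat_exp X $$ (r, c) = jsgn n r * jsgn n c * cnj (mat_exp X $$ (jconj n r, jconj n c))"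
    using mat_exp_entry_sums[OF X rc] sums_unique2 by simp
qed

lemma mat_adjoint_dim: "dim_row (mat_adjoint A) = dim_col A" "dim_col (mat_adjoint A) = dim_row A"
  by (auto simp: mat_adjoint_def)

lemma mat_adjoint_carrier: "A \<in> carrier_mat m k \<Longrightarrow> mat_adjoint A \<in> carrier_mat k m"
  using carrier_matD[of A m k] by (intro carrier_matI) (simp_all add: mat_adjoint_dim)

lemma mat_adjoint_index:
  fixes A :: "complex mat"
  assumes "A \<in> carrier_mat m k" "r < k" "c < m"
  shows "mat_adjoint A $$ (r, c) = cnj (A $$ (c, r))"
  using assms by (auto simp: mat_adjoint_def mat_of_rows_def)

lemma pow_mat_adjoint_index:
  fixes A :: "complex mat"
  assumes A: "A \<in> carrier_mat m m" and "r < m" "c < m"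
  shows "(mat_adjoint A ^\<^sub>m k) $$ (r, c) = cnj ((A ^\<^sub>m k) $$ (c, r))"
  using assms(2,3)
proof (induction k arbitrary: r c)
  case 0
  then show ?case using A by (simp add: mat_adjoint_dim)
next
  case (Suc k)
  have A': "mat_adjoint A \<in> carrier_mat m m"
    using A by (rule mat_adjoint_carrier)
  have "(mat_adjoint A ^\<^sub>m Suc k) $$ (r, c) = (\<Sum>s<m. (mat_adjoint A ^\<^sub>m k) $$ (r, s) * mat_adjoint A $$ (s, c))"
    using A' Suc.prems by (simp add: index_mult_mat_sum[of _ m m _ m] del: index_mult_mat)
  also have "\<dots> = (\<Sum>s<m. cnj (A $$ (c, s) * (A ^\<^sub>m k) $$ (s, r)))"
    using Suc A by (intro sum.cong refl) (simp add: mat_adjoint_index mult.commute)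
  also have "\<dots> = cnj ((A ^\<^sub>m Suc k) $$ (c, r))"
    using A Suc.prems
    by (simp add: pow_mat_Suc_left[of _ m] index_mult_mat_sum[of _ m m _ m] del: index_mult_mat pow_mat.simps)
  finally show ?case .
qed

lemma mat_exp_adjoint:
  fixes A :: "complex mat"
  assumes A: "A \<in> carrier_mat m m"
  shows "mat_exp (mat_adjoint A) = mat_adjoint (mat_exp A)"
proof (rule eq_matI)
  note A' = mat_adjoint_carrier[OF A]
  note E = mat_exp_carrier[OF A]
  fix r c assume "r < dim_row (mat_adjoint (mat_exp A))" "c < dim_col (mat_adjoint (mat_exp A))"
  then have rc: "r < m" "c < m" using carrier_matD[OF E] by (simp_all add: mat_adjoint_dim)
  have "(\<lambda>k. cnj ((A ^\<^sub>m k) $$ (c, r) / fact k)) sums cnj (mat_exp A $$ (c, r))"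
    using mat_exp_entry_sums[OF A rc(2,1)] by (simp only: sums_cnj)
  then have "(\<lambda>k. (mat_adjoint A ^\<^sub>m k) $$ (r, c) / fact k) sums cnj (mat_exp A $$ (c, r))"
    using A rc by (simp add: pow_mat_adjoint_index)
  then show "mat_exp (mat_adjoint A) $$ (r, c) = mat_adjoint (mat_exp A) $$ (r, c)"
    using mat_exp_entry_sums[OF A' rc] sums_unique2 mat_adjoint_index[OF E rc] by simp
qed (use carrier_matD[OF A] in \<open>simp_all add: mat_adjoint_dim mat_exp_def\<close>)

lemma vector_derivative_at_unique:
  assumes "(f has_vector_derivative D) (at x)" "(f has_vector_derivative D') (at x)"
  shows "D = D'"
  using has_derivative_unique[OF assms[unfolded has_vector_derivative_def]]
  by (metis scaleR_one)

definition skew_hermitian :: "complex mat \<Rightarrow> bool" where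
  "skew_hermitian X \<longleftrightarrow> mat_adjoint X = - X"

text \<open>If \<open>X\<close> is skew-Hermitian then the adjoint of \<open>exp (s X)\<close> is its inverse \<open>exp (- s X)\<close>; conversely
  this equation is differentiated at \<open>s = 0\<close>. The quaternionic condition passes through the entrywise
  series in one direction and is differentiated in the other.\<close>

lemma lie_algebra_Sp:
  "lie_algebra (2 * n) (Sp n) =
    {X \<in> carrier_mat (2 * n) (2 * n). skew_hermitian X \<and> quaternionic n X}" (is "?L = ?R")
proof
  show "?R \<subseteq> ?L"
  proof
    fix X assume "X \<in> ?R"
    then have X: "X \<in> carrier_mat (2 * n) (2 * n)" and sk: "mat_adjoint X = - X" and Q: "quaternionic n X"
      by (auto simp: skew_hermitian_def)
    have "mat_exp (complex_of_real s \<cdot>\<^sub>m X) \<in> Sp n" for s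
    proof -
      let ?Y = "complex_of_real s \<cdot>\<^sub>m X"
      have Y: "?Y \<in> carrier_mat (2 * n) (2 * n)" using X by simp
      have "quaternionic n ?Y"
        unfolding quaternionic_def
      proof (intro allI impI)
        fix r c assume rc: "r < 2 * n" "c < 2 * n"
        have "X $$ (r, c) = jsgn n r * jsgn n c * cnj (X $$ (jconj n r, jconj n c))"
          using Q rc unfolding quaternionic_def by blast
        then show "?Y $$ (r, c) = jsgn n r * jsgn n c * cnj (?Y $$ (jconj n r, jconj n c))"
          using X rc by (simp add: jconj_simps)
      qed
      then have "quaternionic n (mat_exp ?Y)"
        by (rule quaternionic_mat_exp[OF Y])
      moreover have "mat_adjoint ?Y = - ?Y"
      proof (rule eq_matI)
        fix r c assume "r < dim_row (- ?Y)" "c < dim_col (- ?Y)"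
        then have rc: "r < 2 * n" "c < 2 * n" using X by auto
        have "mat_adjoint X $$ (r, c) = (- X) $$ (r, c)"
          using sk by simp
        then have "cnj (X $$ (c, r)) = - X $$ (r, c)"
          using X rc by (simp add: mat_adjoint_index)
        then show "mat_adjoint ?Y $$ (r, c) = (- ?Y) $$ (r, c)"
          using X rc mat_adjoint_index[OF Y rc] by simp
      qed (use X in \<open>auto simp: mat_adjoint_dim\<close>)
      then have "mat_adjoint (mat_exp ?Y) = mat_exp (- ?Y)"
        using mat_exp_adjoint[OF Y] by simp
      ultimately show ?thesis
        using mat_exp_uminus_inverse[OF Y] mat_exp_carrier[OF Y] commutes_J_map_iff_quaternionic[of "mat_exp ?Y" n]
        unfolding Sp_def by auto
    qed
    then show "X \<in> ?L" using X by (auto simp: lie_algebra_def)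
  qed
next
  show "?L \<subseteq> ?R"
  proof
    fix X assume "X \<in> ?L"
    then have X: "X \<in> carrier_mat (2 * n) (2 * n)"
      and S: "\<And>s::real. mat_exp (complex_of_real s \<cdot>\<^sub>m X) \<in> Sp n"
      by (auto simp: lie_algebra_def)
    let ?e = "\<lambda>s::real. mat_exp (complex_of_real s \<cdot>\<^sub>m X)"
    have c: "?e s \<in> carrier_mat (2 * n) (2 * n)" for s using X by simp
    have "quaternionic n X"
      unfolding quaternionic_def
    proof (intro allI impI)
      fix r c assume rc: "r < 2 * n" "c < 2 * n"
      have "quaternionic n (?e s)" for s
        using S[of s] commutes_J_map_iff_quaternionic[OF c] unfolding Sp_def by auto
      then have eq: "?e s $$ (r, c) = jsgn n r * jsgn n c * cnj (?e s $$ (jconj n r, jconj n c))" for s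
        using rc unfolding quaternionic_def by blast
      have "((\<lambda>s. jsgn n r * jsgn n c * cnj (?e s $$ (jconj n r, jconj n c))) has_vector_derivative
          jsgn n r * jsgn n c * cnj (X $$ (jconj n r, jconj n c))) (at 0)"
        using X rc
        by (intro has_vector_derivative_mult_right has_vector_derivative_cnj mat_exp_entry_deriv_0[of _ "2 * n"])
          (auto simp: jconj_simps)
      then have "((\<lambda>s. ?e s $$ (r, c)) has_vector_derivative
          jsgn n r * jsgn n c * cnj (X $$ (jconj n r, jconj n c))) (at 0)"
        by (simp only: eq[symmetric])
      then show "X $$ (r, c) = jsgn n r * jsgn n c * cnj (X $$ (jconj n r, jconj n c))"
        using mat_exp_entry_deriv_0[OF X rc] vector_derivative_at_unique by blast
    qed
    moreover have "mat_adjoint X = - X"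
    proof (rule eq_matI)
      fix r c' assume "r < dim_row (- X)" "c' < dim_col (- X)"
      then have rc: "r < 2 * n" "c' < 2 * n" using X by auto
      have adj: "mat_adjoint (?e s) = mat_exp (complex_of_real s \<cdot>\<^sub>m (- X))" for s
      proof -
        let ?Y = "complex_of_real s \<cdot>\<^sub>m X"
        have Y: "?Y \<in> carrier_mat (2 * n) (2 * n)" using X by simp
        have Y': "mat_exp (- ?Y) \<in> carrier_mat (2 * n) (2 * n)"
          using Y by simp
        have "mat_adjoint (?e s) = mat_adjoint (?e s) * (?e s * mat_exp (- ?Y))"
          by (simp only: mat_exp_uminus_inverse[OF Y] right_mult_one_mat[OF mat_adjoint_carrier[OF c]])
        also have "\<dots> = (mat_adjoint (?e s) * ?e s) * mat_exp (- ?Y)"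
          by (rule assoc_mult_mat[OF mat_adjoint_carrier[OF c] c Y', symmetric])
        also have "mat_adjoint (?e s) * ?e s = 1\<^sub>m (2 * n)"
          using S[of s] unfolding Sp_def by blast
        also have "1\<^sub>m (2 * n) * mat_exp (- ?Y) = mat_exp (- ?Y)"
          by (rule left_mult_one_mat[OF Y'])
        also have "- ?Y = complex_of_real s \<cdot>\<^sub>m (- X)"
          by (rule eq_matI) auto
        finally show ?thesis .
      qed
      have eq: "cnj (?e s $$ (c', r)) = mat_exp (complex_of_real s \<cdot>\<^sub>m (- X)) $$ (r, c')" for s
        using adj[of s] mat_adjoint_index[OF c rc, of s] by simp
      have "((\<lambda>s. cnj (?e s $$ (c', r))) has_vector_derivative cnj (X $$ (c', r))) (at 0)"
        by (intro has_vector_derivative_cnj mat_exp_entry_deriv_0[OF X rc(2,1)])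
      moreover have "((\<lambda>s. cnj (?e s $$ (c', r))) has_vector_derivative (- X) $$ (r, c')) (at 0)"
        unfolding eq by (rule mat_exp_entry_deriv_0) (use X rc in auto)
      ultimately have "cnj (X $$ (c', r)) = (- X) $$ (r, c')"
        by (rule vector_derivative_at_unique)
      then show "mat_adjoint X $$ (r, c') = (- X) $$ (r, c')"
        using mat_adjoint_index[OF X rc] by simp
    qed (use X in \<open>auto simp: mat_adjoint_dim\<close>)
    ultimately show "X \<in> ?R" using X by (simp add: skew_hermitian_def)
  qed
qed

text \<open>Eliminating the complex conjugate between the skew-Hermitian and the quaternionic condition leaves
  a complex linear condition, which thus survives complexification. It is invariant under adjoints,
  so both parts of the decomposition into a skew-Hermitian and a Hermitian matrix satisfy it again.\<close>

lemma spC_iff: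
  "X \<in> spC n \<longleftrightarrow> X \<in> carrier_mat (2 * n) (2 * n) \<and>
    (\<forall>r<2 * n. \<forall>c<2 * n. X $$ (r, c) = - (jsgn n r * jsgn n c * X $$ (jconj n c, jconj n r)))"
proof
  assume "X \<in> spC n"
  then obtain A B where X: "X = A + \<i> \<cdot>\<^sub>m B"
    and AB: "A \<in> lie_algebra (2 * n) (Sp n)" "B \<in> lie_algebra (2 * n) (Sp n)"
    unfolding spC_def complexification_def by auto
  have car: "Y \<in> carrier_mat (2 * n) (2 * n)" if "Y \<in> lie_algebra (2 * n) (Sp n)" for Y
    using that by (simp add: lie_algebra_Sp)
  have ent: "Y $$ (r, c) = - (jsgn n r * jsgn n c * Y $$ (jconj n c, jconj n r))"
    if Y: "Y \<in> lie_algebra (2 * n) (Sp n)" and rc: "r < 2 * n" "c < 2 * n" for Y r c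
  proof -
    have "cnj (Y $$ (jconj n r, jconj n c)) = mat_adjoint Y $$ (jconj n c, jconj n r)"
      using car[OF Y] rc by (simp add: mat_adjoint_index jconj_simps)
    also have "\<dots> = - Y $$ (jconj n c, jconj n r)"
      using Y car[OF Y] rc by (simp add: lie_algebra_Sp skew_hermitian_def jconj_simps)
    finally have "cnj (Y $$ (jconj n r, jconj n c)) = - Y $$ (jconj n c, jconj n r)" .
    moreover have "Y $$ (r, c) = jsgn n r * jsgn n c * cnj (Y $$ (jconj n r, jconj n c))"
      using Y rc by (auto simp: lie_algebra_Sp quaternionic_def)
    ultimately show ?thesis by simp
  qed
  have "X $$ (r, c) = - (jsgn n r * jsgn n c * X $$ (jconj n c, jconj n r))"
    if rc: "r < 2 * n" "c < 2 * n" for r c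
  proof -
    have idx: "X $$ (r, c) = A $$ (r, c) + \<i> * B $$ (r, c)" if "r < 2 * n" "c < 2 * n" for r c
      using that car[OF AB(1)] car[OF AB(2)] by (simp add: X)
    show ?thesis
      unfolding idx[OF rc] idx[OF jconj_less[OF rc(2)] jconj_less[OF rc(1)]] ent[OF AB(1) rc] ent[OF AB(2) rc]
      by (simp add: algebra_simps)
  qed
  then show "X \<in> carrier_mat (2 * n) (2 * n) \<and>
      (\<forall>r<2 * n. \<forall>c<2 * n. X $$ (r, c) = - (jsgn n r * jsgn n c * X $$ (jconj n c, jconj n r)))"
    using car[OF AB(1)] car[OF AB(2)] by (auto simp: X)
next
  assume "X \<in> carrier_mat (2 * n) (2 * n) \<and>
    (\<forall>r<2 * n. \<forall>c<2 * n. X $$ (r, c) = - (jsgn n r * jsgn n c * X $$ (jconj n c, jconj n r)))"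
  then have X: "X \<in> carrier_mat (2 * n) (2 * n)"
    and ent: "\<And>r c. r < 2 * n \<Longrightarrow> c < 2 * n \<Longrightarrow> X $$ (r, c) = - (jsgn n r * jsgn n c * X $$ (jconj n c, jconj n r))"
    by auto
  have part: "mat (2 * n) (2 * n) (\<lambda>(r, c). (z * X $$ (r, c) - cnj (z * X $$ (c, r))) / 2)
      \<in> lie_algebra (2 * n) (Sp n)" (is "?Y \<in> _") for z
  proof -
    have "mat_adjoint ?Y = - ?Y"
    proof (rule eq_matI)
      fix r c assume "r < dim_row (- ?Y)" "c < dim_col (- ?Y)"
      then have rc: "r < 2 * n" "c < 2 * n" by auto
      show "mat_adjoint ?Y $$ (r, c) = (- ?Y) $$ (r, c)"
        using rc by (subst mat_adjoint_index[of _ "2 * n" "2 * n"]) (auto simp: field_simps)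
    qed (auto simp: mat_adjoint_dim)
    moreover have "quaternionic n ?Y"
      unfolding quaternionic_def
    proof (intro allI impI)
      fix r c assume rc: "r < 2 * n" "c < 2 * n"
      have idx: "?Y $$ (r, c) = (z * X $$ (r, c) - cnj (z * X $$ (c, r))) / 2" if "r < 2 * n" "c < 2 * n" for r c
        using that by simp
      show "?Y $$ (r, c) = jsgn n r * jsgn n c * cnj (?Y $$ (jconj n r, jconj n c))"
        unfolding idx[OF rc] idx[OF jconj_less[OF rc(1)] jconj_less[OF rc(2)]] ent[OF rc] ent[OF rc(2,1)]
        by (simp add: cnj_jsgn algebra_simps)
    qed
    ultimately show ?thesis by (simp add: lie_algebra_Sp skew_hermitian_def)
  qed
  \<comment> \<open>\<open>X\<close> is the sum of its skew-Hermitian part and \<open>\<i>\<close> times that of \<open>- \<i> X\<close>.\<close>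
  have "X = mat (2 * n) (2 * n) (\<lambda>(r, c). (1 * X $$ (r, c) - cnj (1 * X $$ (c, r))) / 2) +
      \<i> \<cdot>\<^sub>m mat (2 * n) (2 * n) (\<lambda>(r, c). (- \<i> * X $$ (r, c) - cnj (- \<i> * X $$ (c, r))) / 2)"
    using X by (intro eq_matI) (auto simp: field_simps)
  then show "X \<in> spC n"
    unfolding spC_def complexification_def using part[of 1] part[of "- \<i>"] by blast
qed

section \<open>The torus and its root data\<close>

text \<open>The torus element with coordinates \<open>a\<^sub>1, \<dots>, a\<^sub>n\<close> has the diagonal
  \<open>\<i> (a\<^sub>1, \<dots>, a\<^sub>n, - a\<^sub>1, \<dots>, - a\<^sub>n)\<close>; the factor \<open>\<i>\<close> is split off to stay in the reals.\<close>

definition diag_entry :: "nat \<Rightarrow> (nat \<Rightarrow> real) \<Rightarrow> nat \<Rightarrow> real" where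
  "diag_entry n a r = (if r < n then a (r + 1) else - a (r - n + 1))"

definition torus_elem :: "nat \<Rightarrow> (nat \<Rightarrow> real) \<Rightarrow> complex mat" where
  "torus_elem n a = mat (2 * n) (2 * n) (\<lambda>(r, c). if r = c then \<i> * complex_of_real (diag_entry n a r) else 0)"

lemma torus_elem_carrier [simp]: "torus_elem n a \<in> carrier_mat (2 * n) (2 * n)"
  by (simp add: torus_elem_def)

lemma torus_elem_index:
  "r < 2 * n \<Longrightarrow> c < 2 * n \<Longrightarrow>
    torus_elem n a $$ (r, c) = (if r = c then \<i> * complex_of_real (diag_entry n a r) else 0)"
  by (simp add: torus_elem_def)

lemma torus_elem_eqI:
  assumes "X \<in> carrier_mat (2 * n) (2 * n)"
    and "\<And>r c. r < 2 * n \<Longrightarrow> c < 2 * n \<Longrightarrow>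
      X $$ (r, c) = (if r = c then \<i> * complex_of_real (diag_entry n a r) else 0)"
  shows "X = torus_elem n a"
  using assms by (intro eq_matI) (auto simp: torus_elem_def)

lemma diag_entry_jconj: "r < 2 * n \<Longrightarrow> diag_entry n a (jconj n r) = - diag_entry n a r"
  by (auto simp: diag_entry_def jconj_def)

lemma diag_entry_add: "diag_entry n (\<lambda>i. a i + b i) r = diag_entry n a r + diag_entry n b r"
  by (simp add: diag_entry_def)

lemma diag_entry_scale: "diag_entry n (\<lambda>i. x * a i) r = x * diag_entry n a r"
  by (simp add: diag_entry_def)

lemma diag_entry_sum: "diag_entry n (\<lambda>i. \<Sum>s\<in>S. b s i) r = (\<Sum>s\<in>S. diag_entry n (b s) r)"
  by (simp add: diag_entry_def sum_negf)

lemma L_torus_elem: "i \<in> {1..n} \<Longrightarrow> L i (torus_elem n a) = \<i> * complex_of_real (a i)"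
  by (auto simp: L_def torus_elem_def diag_entry_def)

lemma torus_elem_cong:
  assumes "\<And>i. i \<in> {1..n} \<Longrightarrow> a i = b i"
  shows "torus_elem n a = torus_elem n b"
proof (rule torus_elem_eqI[OF torus_elem_carrier])
  fix r c assume rc: "r < 2 * n" "c < 2 * n"
  have "diag_entry n a r = diag_entry n b r"
  proof (cases "r < n")
    case True
    then show ?thesis using assms[of "r + 1"] by (simp add: diag_entry_def)
  next
    case False
    then have "r - n + 1 \<in> {1..n}" using rc by auto
    then show ?thesis using False assms[of "r - n + 1"] by (simp add: diag_entry_def)
  qed
  then show "torus_elem n a $$ (r, c) = (if r = c then \<i> * complex_of_real (diag_entry n b r) else 0)"
    using rc by (auto simp: torus_elem_index)
qed

lemma torus_elem_in_spC: "torus_elem n a \<in> spC n"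
  unfolding spC_iff
proof (intro conjI allI impI)
  fix r c assume rc: "r < 2 * n" "c < 2 * n"
  then have "jconj n c = jconj n r \<longleftrightarrow> r = c"
    by (metis jconj_jconj)
  then show "torus_elem n a $$ (r, c) = - (jsgn n r * jsgn n c * torus_elem n a $$ (jconj n c, jconj n r))"
    using rc by (simp add: torus_elem_index jconj_simps diag_entry_jconj)
qed simp

lemma smult_torus_elem: "complex_of_real x \<cdot>\<^sub>m torus_elem n a = torus_elem n (\<lambda>i. x * a i)"
  by (rule torus_elem_eqI) (auto simp: torus_elem_def diag_entry_scale)

lemma add_torus_elem: "torus_elem n a + torus_elem n b = torus_elem n (\<lambda>i. a i + b i)"
  by (rule torus_elem_eqI) (auto simp: torus_elem_def diag_entry_add distrib_left)

lemma mat_sum_torus_elem: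
  assumes "\<And>s. s \<in> S \<Longrightarrow> F s = torus_elem n (b s)"
  shows "mat_sum (2 * n) F S = torus_elem n (\<lambda>i. \<Sum>s\<in>S. b s i)"
proof (rule torus_elem_eqI)
  fix r c assume rc: "r < 2 * n" "c < 2 * n"
  have "mat_sum (2 * n) F S $$ (r, c) = (\<Sum>s\<in>S. torus_elem n (b s) $$ (r, c))"
    using rc assms by (simp add: mat_sum_def)
  then show "mat_sum (2 * n) F S $$ (r, c) =
      (if r = c then \<i> * complex_of_real (diag_entry n (\<lambda>i. \<Sum>s\<in>S. b s i) r) else 0)"
    using rc by (simp add: torus_elem_index diag_entry_sum sum_distrib_left)
qed (simp add: mat_sum_def)

lemma E_eq_torus_elem:
  assumes "i \<in> {1..n}"
  shows "E n i = torus_elem n (\<lambda>j. if j = i then 1 else 0)"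
proof (rule torus_elem_eqI)
  fix r c assume rc: "r < 2 * n" "c < 2 * n"
  have "r = i - 1 \<longleftrightarrow> r + 1 = i" "r = n + i - 1 \<longleftrightarrow> \<not> r < n \<and> r - n + 1 = i"
    using assms by auto
  then show "E n i $$ (r, c) =
      (if r = c then \<i> * complex_of_real (diag_entry n (\<lambda>j. if j = i then 1 else 0) r) else 0)"
    using rc assms by (auto simp: E_def diag_entry_def)
qed (simp add: E_def)

lemma torus_eq: "torus n = range (torus_elem n)"
proof -
  have "mat_sum (2 * n) (\<lambda>i. complex_of_real (a i) \<cdot>\<^sub>m E n i) {1..n} = torus_elem n a" for a
  proof -
    have "mat_sum (2 * n) (\<lambda>i. complex_of_real (a i) \<cdot>\<^sub>m E n i) {1..n} =
        torus_elem n (\<lambda>j. \<Sum>i\<in>{1..n}. a i * (if j = i then 1 else 0))"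
      by (rule mat_sum_torus_elem) (simp add: E_eq_torus_elem smult_torus_elem)
    also have "\<dots> = torus_elem n a"
      by (rule torus_elem_cong) (simp add: if_distrib cong: if_cong)
    finally show ?thesis .
  qed
  then show ?thesis unfolding torus_def by auto
qed

lemma torus_subset_spC: "torus n \<subseteq> spC n"
  by (auto simp: torus_eq torus_elem_in_spC)

text \<open>The coefficient of \<open>E\<^sub>i\<close> in \<open>H\<^sub>j\<close>, meaningful for \<open>i\<close> and \<open>j\<close> between \<open>1\<close> and \<open>n\<close>.\<close>

definition H_coeff :: "nat \<Rightarrow> nat \<Rightarrow> nat \<Rightarrow> real" where
  "H_coeff n j i = (if j < n then if i \<le> j then 1 else 0 else 1 / 2)"

lemma H_eq_torus_elem:
  assumes "j \<in> {1..n}"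
  shows "H n j = torus_elem n (H_coeff n j)"
proof -
  have sum: "mat_sum (2 * n) (E n) {1..k} = torus_elem n (\<lambda>i. if i \<le> k then 1 else 0)" if "k \<le> n" for k
  proof -
    have "mat_sum (2 * n) (E n) {1..k} = torus_elem n (\<lambda>i. \<Sum>s\<in>{1..k}. if i = s then 1 else 0)"
      by (rule mat_sum_torus_elem) (use that in \<open>simp add: E_eq_torus_elem\<close>)
    also have "\<dots> = torus_elem n (\<lambda>i. if i \<le> k then 1 else 0)"
      by (rule torus_elem_cong) auto
    finally show ?thesis .
  qed
  show ?thesis
  proof (cases "j < n")
    case True
    then have "H n j = torus_elem n (\<lambda>i. if i \<le> j then 1 else 0)"
      using sum[of j] by (simp add: H_def)
    also have "\<dots> = torus_elem n (H_coeff n j)"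
      using True by (intro torus_elem_cong) (simp add: H_coeff_def)
    finally show ?thesis .
  next
    case False
    then have "H n j = complex_of_real (1 / 2) \<cdot>\<^sub>m torus_elem n (\<lambda>i. if i \<le> n then 1 else 0)"
      using sum[of n] by (simp add: H_def)
    also have "\<dots> = torus_elem n (H_coeff n j)"
      unfolding smult_torus_elem using False by (intro torus_elem_cong) (simp add: H_coeff_def)
    finally show ?thesis .
  qed
qed

text \<open>The coefficient of \<open>E\<^sub>i\<close> in \<open>\<Sum>\<^sub>j a\<^sub>j H\<^sub>j\<close>.\<close>

definition H_comb :: "nat \<Rightarrow> (nat \<Rightarrow> real) \<Rightarrow> nat \<Rightarrow> real" where
  "H_comb n a i = (\<Sum>j=1..n. a j * H_coeff n j i)"

lemma cone_eq:
  "cone n I = {torus_elem n (H_comb n a) | a. \<forall>j\<in>{1..n}. a j \<ge> 0 \<and> (a j = 0 \<longleftrightarrow> j \<notin> I)}"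
proof -
  have "mat_sum (2 * n) (\<lambda>i. complex_of_real (a i) \<cdot>\<^sub>m H n i) {1..n} = torus_elem n (H_comb n a)" for a
  proof -
    have "H_comb n a = (\<lambda>i. \<Sum>j=1..n. a j * H_coeff n j i)"
      by (simp add: H_comb_def fun_eq_iff)
    moreover have "mat_sum (2 * n) (\<lambda>i. complex_of_real (a i) \<cdot>\<^sub>m H n i) {1..n} =
        torus_elem n (\<lambda>i. \<Sum>j=1..n. a j * H_coeff n j i)"
      by (rule mat_sum_torus_elem) (simp add: H_eq_torus_elem smult_torus_elem)
    ultimately show ?thesis by simp
  qed
  then show ?thesis unfolding cone_def by simp
qed

text \<open>The simple roots recover the coordinates with respect to the \<open>H\<^sub>j\<close>: \<open>2 L\<^sub>n\<close> the last one, and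
  \<open>L\<^sub>i - L\<^sub>i\<^sub>+\<^sub>1\<close> the others.\<close>

lemma H_comb_last: "n \<ge> 1 \<Longrightarrow> H_comb n a n = a n / 2"
proof -
  assume "n \<ge> 1"
  have "H_comb n a n = (\<Sum>j=1..n. if j = n then a n / 2 else 0)"
    unfolding H_comb_def by (intro sum.cong) (auto simp: H_coeff_def)
  then show ?thesis using \<open>n \<ge> 1\<close> by simp
qed

lemma H_comb_diff: "i \<in> {1..<n} \<Longrightarrow> H_comb n a i - H_comb n a (Suc i) = a i"
proof -
  assume i: "i \<in> {1..<n}"
  have "H_comb n a i - H_comb n a (Suc i) = (\<Sum>j=1..n. if j = i then a i else 0)"
    unfolding H_comb_def sum_subtractf[symmetric]
    by (intro sum.cong) (use i in \<open>auto simp: H_coeff_def\<close>)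
  then show ?thesis using i by simp
qed

lemma exp_2pi_i_eq_1_iff: "exp (complex_of_real (2 * pi) * (\<i> * complex_of_real x)) = 1 \<longleftrightarrow> x \<in> \<int>"
proof -
  have "exp (complex_of_real (2 * pi) * (\<i> * complex_of_real x)) = cis (2 * pi * x)"
    by (simp add: cis_conv_exp mult_ac)
  also have "cis (2 * pi * x) = 1 \<longleftrightarrow> cos (2 * pi * x) = 1"
  proof
    assume "cos (2 * pi * x) = 1"
    moreover from this have "sin (2 * pi * x) = 0"
      using sin_cos_squared_add[of "2 * pi * x"] by simp
    ultimately show "cis (2 * pi * x) = 1" by (simp add: complex_eq_iff)
  qed (metis cis.sel(1) one_complex.sel(1))
  also have "\<dots> \<longleftrightarrow> (\<exists>k::int. 2 * pi * x = of_int k * 2 * pi)"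
    by (simp add: cos_one_2pi_int)
  also have "\<dots> \<longleftrightarrow> x \<in> \<int>"
    by (auto simp: Ints_def)
  finally show ?thesis .
qed

lemma diag_entry_Ints_iff: "(\<forall>r<2 * n. diag_entry n a r \<in> \<int>) \<longleftrightarrow> (\<forall>i\<in>{1..n}. a i \<in> \<int>)"
proof safe
  fix i assume *: "\<forall>r<2 * n. diag_entry n a r \<in> \<int>" and "i \<in> {1..n}"
  then have "i - 1 < 2 * n" "i - 1 < n" "i - 1 + 1 = i" by auto
  then show "a i \<in> \<int>" using *[rule_format, of "i - 1"] by (simp add: diag_entry_def)
next
  fix r assume *: "\<forall>i\<in>{1..n}. a i \<in> \<int>" and "r < 2 * n"
  then have "r < n \<Longrightarrow> r + 1 \<in> {1..n}" "\<not> r < n \<Longrightarrow> r - n + 1 \<in> {1..n}" by auto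
  then show "diag_entry n a r \<in> \<int>"
    using * by (auto simp: diag_entry_def simp del: atLeastAtMost_iff)
qed

lemma torus_elem_in_int_lattice_iff:
  "torus_elem n a \<in> int_lattice n \<longleftrightarrow> (\<forall>i\<in>{1..n}. a i \<in> \<int>)"
proof -
  let ?D = "\<lambda>r. complex_of_real (2 * pi) * (\<i> * complex_of_real (diag_entry n a r))"
  have "complex_of_real (2 * pi) \<cdot>\<^sub>m torus_elem n a = mat (2 * n) (2 * n) (\<lambda>(r, c). if r = c then ?D r else 0)"
    by (rule eq_matI) (auto simp: torus_elem_def)
  then have exp: "mat_exp (complex_of_real (2 * pi) \<cdot>\<^sub>m torus_elem n a) =
      mat (2 * n) (2 * n) (\<lambda>(r, c). if r = c then exp (?D r) else 0)"
    by (simp only: mat_exp_diag)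
  have "mat (2 * n) (2 * n) (\<lambda>(r, c). if r = c then exp (?D r) else 0) = 1\<^sub>m (2 * n) \<longleftrightarrow>
      (\<forall>r<2 * n. exp (?D r) = 1)"
  proof
    assume eq: "mat (2 * n) (2 * n) (\<lambda>(r, c). if r = c then exp (?D r) else 0) = 1\<^sub>m (2 * n)"
    show "\<forall>r<2 * n. exp (?D r) = 1"
    proof (intro allI impI)
      fix r assume r: "r < 2 * n"
      have "mat (2 * n) (2 * n) (\<lambda>(r, c). if r = c then exp (?D r) else 0) $$ (r, r) = 1\<^sub>m (2 * n) $$ (r, r)"
        by (simp only: eq)
      then show "exp (?D r) = 1" using r by simp
    qed
  next
    assume "\<forall>r<2 * n. exp (?D r) = 1"
    then show "mat (2 * n) (2 * n) (\<lambda>(r, c). if r = c then exp (?D r) else 0) = 1\<^sub>m (2 * n)"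
      by (intro eq_matI) auto
  qed
  then show ?thesis
    unfolding int_lattice_def using exp by (simp add: torus_eq exp_2pi_i_eq_1_iff diag_entry_Ints_iff del: of_real_mult)
qed

section \<open>Parabolic filtrations and the partial order\<close>

lemma bracket_carrier: "A \<in> carrier_mat m m \<Longrightarrow> B \<in> carrier_mat m m \<Longrightarrow> bracket A B \<in> carrier_mat m m"
  by (simp add: bracket_def mult_carrier_mat[of _ m m _ m] minus_carrier_mat)

lemma bracket_torus_elem_index:
  assumes X: "X \<in> carrier_mat (2 * n) (2 * n)" and rc: "r < 2 * n" "c < 2 * n"
  shows "bracket (torus_elem n a) X $$ (r, c) =
    \<i> * complex_of_real (diag_entry n a r - diag_entry n a c) * X $$ (r, c)"
proof -
  have "(torus_elem n a * X) $$ (r, c) = (\<Sum>s<2 * n. torus_elem n a $$ (r, s) * X $$ (s, c))"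
    using X rc by (intro index_mult_mat_sum) auto
  also have "\<dots> = (\<Sum>s<2 * n. if s = r then \<i> * complex_of_real (diag_entry n a r) * X $$ (r, c) else 0)"
    using rc by (intro sum.cong) (auto simp: torus_elem_index)
  finally have 1: "(torus_elem n a * X) $$ (r, c) = \<i> * complex_of_real (diag_entry n a r) * X $$ (r, c)"
    using rc by simp
  have "(X * torus_elem n a) $$ (r, c) = (\<Sum>s<2 * n. X $$ (r, s) * torus_elem n a $$ (s, c))"
    using X rc by (intro index_mult_mat_sum) auto
  also have "\<dots> = (\<Sum>s<2 * n. if s = c then \<i> * complex_of_real (diag_entry n a c) * X $$ (r, c) else 0)"
    using rc by (intro sum.cong) (auto simp: torus_elem_index)
  finally have 2: "(X * torus_elem n a) $$ (r, c) = \<i> * complex_of_real (diag_entry n a c) * X $$ (r, c)"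
    using rc by simp
  have "bracket (torus_elem n a) X $$ (r, c) = (torus_elem n a * X) $$ (r, c) - (X * torus_elem n a) $$ (r, c)"
    using carrier_matD[OF X] carrier_matD[OF torus_elem_carrier[of n a]] rc
    by (simp add: bracket_def del: index_mult_mat(1))
  then show ?thesis by (simp add: 1 2 left_diff_distrib right_diff_distrib)
qed

lemma ad_eigenspace_torus_elem_iff:
  "X \<in> ad_eigenspace (spC n) (torus_elem n a) j \<longleftrightarrow> X \<in> spC n \<and>
    (\<forall>r<2 * n. \<forall>c<2 * n. X $$ (r, c) \<noteq> 0 \<longrightarrow> diag_entry n a r - diag_entry n a c = of_int j)"
proof (cases "X \<in> spC n")
  case True
  then have X: "X \<in> carrier_mat (2 * n) (2 * n)"
    by (simp add: spC_iff)
  have eq: "\<i> * complex_of_real x * z = \<i> * of_int j * z \<longleftrightarrow> (z \<noteq> 0 \<longrightarrow> x = of_int j)" for x z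
    using of_real_eq_iff[where 'a = complex, of x "of_int j"] by auto
  have "bracket (torus_elem n a) X = (\<i> * of_int j) \<cdot>\<^sub>m X \<longleftrightarrow>
      (\<forall>r<2 * n. \<forall>c<2 * n. bracket (torus_elem n a) X $$ (r, c) = \<i> * of_int j * X $$ (r, c))"
    (is "?l \<longleftrightarrow> ?r")
  proof
    assume ?l
    then show ?r using X by simp
  next
    assume ?r
    then show ?l
      using X carrier_matD[OF bracket_carrier[OF torus_elem_carrier X]] by (intro eq_matI) auto
  qed
  also have "\<dots> \<longleftrightarrow> (\<forall>r<2 * n. \<forall>c<2 * n. X $$ (r, c) \<noteq> 0 \<longrightarrow> diag_entry n a r - diag_entry n a c = of_int j)"
    using X by (simp only: bracket_torus_elem_index eq cong: imp_cong)
  finally show ?thesis using True by (simp add: ad_eigenspace_def)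
qed (simp add: ad_eigenspace_def)

text \<open>A matrix splits into its eigencomponents under \<open>ad \<xi>\<close> by collecting the entries with a given
  difference of diagonal entries. The defining relation of \<open>spC n\<close> links the positions \<open>(r, c)\<close> and
  \<open>(jconj n c, jconj n r)\<close>, for which this difference is the same; so the components stay in
  \<open>spC n\<close>. Integrality ensures that all eigenvalues are of the form \<open>\<i> j\<close>.\<close>

lemma parab_torus_elem_iff:
  assumes int: "\<forall>i\<in>{1..n}. a i \<in> \<int>"
  shows "X \<in> parab (2 * n) (spC n) (torus_elem n a) i \<longleftrightarrow> X \<in> spC n \<and>
    (\<forall>r<2 * n. \<forall>c<2 * n. X $$ (r, c) \<noteq> 0 \<longrightarrow> diag_entry n a r - diag_entry n a c \<le> of_int i)"
proof
  assume "X \<in> parab (2 * n) (spC n) (torus_elem n a) i"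
  then obtain F S where X: "X = mat_sum (2 * n) F S" and S: "finite S" "S \<subseteq> {..i}"
    and F: "\<And>j. j \<in> S \<Longrightarrow> F j \<in> ad_eigenspace (spC n) (torus_elem n a) j"
    unfolding parab_def by blast
  have idx: "X $$ (r, c) = (\<Sum>j\<in>S. F j $$ (r, c))" if "r < 2 * n" "c < 2 * n" for r c
    using that by (simp add: X mat_sum_def)
  have Xsp: "X \<in> spC n"
    unfolding spC_iff
  proof (intro conjI allI impI)
    show "X \<in> carrier_mat (2 * n) (2 * n)" by (simp add: X mat_sum_def)
    fix r c assume rc: "r < 2 * n" "c < 2 * n"
    have "(\<Sum>j\<in>S. F j $$ (r, c)) = (\<Sum>j\<in>S. - (jsgn n r * jsgn n c * F j $$ (jconj n c, jconj n r)))"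
    proof (intro sum.cong refl)
      fix j assume "j \<in> S"
      then have "F j \<in> spC n" using F by (simp add: ad_eigenspace_def)
      then show "F j $$ (r, c) = - (jsgn n r * jsgn n c * F j $$ (jconj n c, jconj n r))"
        using rc unfolding spC_iff by blast
    qed
    then show "X $$ (r, c) = - (jsgn n r * jsgn n c * X $$ (jconj n c, jconj n r))"
      unfolding idx[OF rc] idx[OF jconj_less[OF rc(2)] jconj_less[OF rc(1)]]
      by (simp add: sum_negf sum_distrib_left)
  qed
  moreover have "diag_entry n a r - diag_entry n a c \<le> of_int i"
    if rc: "r < 2 * n" "c < 2 * n" and nz: "X $$ (r, c) \<noteq> 0" for r c
  proof -
    obtain j where j: "j \<in> S" "F j $$ (r, c) \<noteq> 0"
      using nz idx[OF rc] by (metis sum.not_neutral_contains_not_neutral)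
    then have "diag_entry n a r - diag_entry n a c = of_int j"
      using F[OF j(1)] rc unfolding ad_eigenspace_torus_elem_iff by blast
    then show ?thesis using j(1) S(2) by auto
  qed
  ultimately show "X \<in> spC n \<and>
    (\<forall>r<2 * n. \<forall>c<2 * n. X $$ (r, c) \<noteq> 0 \<longrightarrow> diag_entry n a r - diag_entry n a c \<le> of_int i)" by blast
next
  assume "X \<in> spC n \<and>
    (\<forall>r<2 * n. \<forall>c<2 * n. X $$ (r, c) \<noteq> 0 \<longrightarrow> diag_entry n a r - diag_entry n a c \<le> of_int i)"
  then have Xsp: "X \<in> spC n"
    and le: "\<And>r c. r < 2 * n \<Longrightarrow> c < 2 * n \<Longrightarrow> X $$ (r, c) \<noteq> 0 \<Longrightarrow> diag_entry n a r - diag_entry n a c \<le> of_int i"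
    by auto
  have X: "X \<in> carrier_mat (2 * n) (2 * n)"
    and ent: "\<And>r c. r < 2 * n \<Longrightarrow> c < 2 * n \<Longrightarrow> X $$ (r, c) = - (jsgn n r * jsgn n c * X $$ (jconj n c, jconj n r))"
    using Xsp unfolding spC_iff by blast+
  define h where "h r c = \<lfloor>diag_entry n a r - diag_entry n a c\<rfloor>" for r c
  have h: "of_int (h r c) = diag_entry n a r - diag_entry n a c" if "r < 2 * n" "c < 2 * n" for r c
    using that int unfolding diag_entry_Ints_iff[symmetric] h_def by simp
  define F where "F j = mat (2 * n) (2 * n) (\<lambda>(r, c). if h r c = j then X $$ (r, c) else 0)" for j
  define S where "S = (\<lambda>(r, c). h r c) ` ({..<2 * n} \<times> {..<2 * n}) \<inter> {..i}"
  have "X = mat_sum (2 * n) F S"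
  proof (rule eq_matI)
    fix r c assume "r < dim_row (mat_sum (2 * n) F S)" "c < dim_col (mat_sum (2 * n) F S)"
    then have rc: "r < 2 * n" "c < 2 * n" by (auto simp: mat_sum_def)
    have "finite S" by (simp add: S_def)
    have "mat_sum (2 * n) F S $$ (r, c) = (\<Sum>j\<in>S. if j = h r c then X $$ (r, c) else 0)"
      using rc by (auto simp: mat_sum_def F_def intro!: sum.cong)
    also have "\<dots> = (if h r c \<in> S then X $$ (r, c) else 0)"
      using \<open>finite S\<close> by simp
    also have "\<dots> = X $$ (r, c)"
    proof -
      have "h r c \<in> S" if "X $$ (r, c) \<noteq> 0"
      proof -
        have "h r c \<le> i" using le[OF rc that] h[OF rc] by linarith
        then show ?thesis using rc unfolding S_def by force
      qed
      then show ?thesis by auto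
    qed
    finally show "X $$ (r, c) = mat_sum (2 * n) F S $$ (r, c)" by simp
  qed (use X in \<open>auto simp: mat_sum_def\<close>)
  moreover have "F j \<in> ad_eigenspace (spC n) (torus_elem n a) j" for j
    unfolding ad_eigenspace_torus_elem_iff
  proof (intro conjI allI impI)
    show "F j \<in> spC n"
      unfolding spC_iff
    proof (intro conjI allI impI)
      fix r c assume rc: "r < 2 * n" "c < 2 * n"
      have "h (jconj n c) (jconj n r) = h r c"
        using rc by (simp add: h_def diag_entry_jconj)
      then show "F j $$ (r, c) = - (jsgn n r * jsgn n c * F j $$ (jconj n c, jconj n r))"
        using rc ent[OF rc] by (simp add: F_def jconj_less)
    qed (simp add: F_def)
  next
    fix r c assume rc: "r < 2 * n" "c < 2 * n" and "F j $$ (r, c) \<noteq> 0"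
    then have "h r c = j" by (auto simp: F_def split: if_splits)
    then show "diag_entry n a r - diag_entry n a c = of_int j" using h[OF rc] by simp
  qed
  moreover have "finite S" "S \<subseteq> {..i}" by (auto simp: S_def)
  ultimately show "X \<in> parab (2 * n) (spC n) (torus_elem n a) i"
    unfolding parab_def by blast
qed

text \<open>The matrix unit at \<open>(r, c)\<close>, symmetrised so as to lie in \<open>spC n\<close>. For \<open>r = jconj n c\<close> both terms
  sit at the same position and add up to \<open>2\<close>: these are the long roots.\<close>

definition root_vector :: "nat \<Rightarrow> nat \<Rightarrow> nat \<Rightarrow> complex mat" where
  "root_vector n r c = mat (2 * n) (2 * n) (\<lambda>(p, q). (if p = r \<and> q = c then 1 else 0) -
     jsgn n r * jsgn n c * (if p = jconj n c \<and> q = jconj n r then 1 else 0))"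

lemma root_vector_in_spC:
  assumes rc: "r < 2 * n" "c < 2 * n"
  shows "root_vector n r c \<in> spC n"
  unfolding spC_iff
proof (intro conjI allI impI)
  fix p q assume pq: "p < 2 * n" "q < 2 * n"
  have 1: "jconj n q = r \<and> jconj n p = c \<longleftrightarrow> p = jconj n c \<and> q = jconj n r"
    using rc pq jconj_jconj by metis
  have 2: "jconj n q = jconj n c \<and> jconj n p = jconj n r \<longleftrightarrow> p = r \<and> q = c"
    using rc pq jconj_jconj by metis
  let ?a = "if p = r \<and> q = c then 1 else 0 :: complex"
  let ?b = "if p = jconj n c \<and> q = jconj n r then 1 else 0 :: complex"
  let ?s = "jsgn n r * jsgn n c"
  have pq_entry: "root_vector n r c $$ (p, q) = ?a - ?s * ?b"
    using pq by (simp add: root_vector_def)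
  have qp_entry: "root_vector n r c $$ (jconj n q, jconj n p) = ?b - ?s * ?a"
    unfolding 1[symmetric] 2[symmetric] using pq by (simp add: root_vector_def jconj_less)
  have ss: "?s * ?s = 1"
    by (simp add: jsgn_def)
  show "root_vector n r c $$ (p, q) = - (jsgn n p * jsgn n q * root_vector n r c $$ (jconj n q, jconj n p))"
  proof (cases "(p = r \<and> q = c) \<or> (p = jconj n c \<and> q = jconj n r)")
    case True
    then have "jsgn n p * jsgn n q = ?s"
      using rc by (auto simp: jsgn_jconj)
    then have "- (jsgn n p * jsgn n q * root_vector n r c $$ (jconj n q, jconj n p)) = ?s * ?s * ?a - ?s * ?b"
      unfolding qp_entry by (simp only: right_diff_distrib minus_diff_eq mult.assoc)
    then show ?thesis
      unfolding pq_entry ss by simp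
  next
    case False
    then have "?a = 0" "?b = 0" by auto
    then show ?thesis unfolding pq_entry qp_entry by simp
  qed
qed (simp add: root_vector_def)

lemma root_vector_in_parab_iff:
  assumes int: "\<forall>i\<in>{1..n}. a i \<in> \<int>" and rc: "r < 2 * n" "c < 2 * n"
  shows "root_vector n r c \<in> parab (2 * n) (spC n) (torus_elem n a) i \<longleftrightarrow>
    diag_entry n a r - diag_entry n a c \<le> of_int i"
proof -
  have entry: "root_vector n r c $$ (r, c) =
      1 - jsgn n r * jsgn n c * (if r = jconj n c \<and> c = jconj n r then 1 else 0)"
    using rc by (simp add: root_vector_def)
  have "root_vector n r c $$ (r, c) \<noteq> 0"
  proof (cases "r = jconj n c \<and> c = jconj n r")
    case True
    then have "jsgn n r = - jsgn n c"
      using rc(2) jsgn_jconj by metis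
    then have "jsgn n r * jsgn n c = - 1"
      by (simp add: jsgn_square)
    then show ?thesis
      unfolding entry if_P[OF True] by simp
  next
    case False
    show ?thesis
      unfolding entry if_not_P[OF False] by simp
  qed
  moreover have "diag_entry n a p - diag_entry n a q = diag_entry n a r - diag_entry n a c"
    if "p < 2 * n" "q < 2 * n" "root_vector n r c $$ (p, q) \<noteq> 0" for p q
    using that rc by (auto simp: root_vector_def diag_entry_jconj split: if_splits)
  ultimately show ?thesis
    unfolding parab_torus_elem_iff[OF int] using root_vector_in_spC[OF rc] rc by metis
qed

lemma diag_entry_H_comb:
  "diag_entry n (H_comb n a) r = (\<Sum>j=1..n. a j * diag_entry n (H_coeff n j) r)"
proof -
  have "H_comb n a = (\<lambda>i. \<Sum>j=1..n. a j * H_coeff n j i)"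
    by (simp add: H_comb_def fun_eq_iff)
  then show ?thesis by (simp only: diag_entry_sum diag_entry_scale)
qed

text \<open>Each root is either nonnegative on all \<open>H\<^sub>j\<close> or nonpositive on all of them, since the
  diagonals of all \<open>- \<i> H\<^sub>j\<close> weakly decrease along the same ordering of the basis vectors,
  \<open>e\<^sub>1, \<dots>, e\<^sub>n, e\<^sub>2\<^sub>n, \<dots>, e\<^sub>n\<^sub>+\<^sub>1\<close>.\<close>

lemma diag_entry_H_coeff_comparable:
  assumes "r < 2 * n" "c < 2 * n"
  shows "(\<forall>j\<in>{1..n}. diag_entry n (H_coeff n j) c \<le> diag_entry n (H_coeff n j) r) \<or>
    (\<forall>j\<in>{1..n}. diag_entry n (H_coeff n j) r \<le> diag_entry n (H_coeff n j) c)"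
proof -
  \<comment> \<open>The position of a basis vector in the ordering described above.\<close>
  define rank where "rank p = (if p < n then p else 3 * n - 1 - p)" for p
  have "diag_entry n (H_coeff n j) q \<le> diag_entry n (H_coeff n j) p"
    if "p < 2 * n" "q < 2 * n" "rank p \<le> rank q" for p q j
    using that by (auto simp: diag_entry_def H_coeff_def rank_def split: if_splits)
  then show ?thesis using assms nat_le_linear[of "rank r" "rank c"] by blast
qed

text \<open>The witness is the position of the vector of the \<open>j\<close>-th simple root, which reads off the \<open>j\<close>-th
  coordinate.\<close>

lemma simple_root_position:
  assumes j: "j \<in> {1..n}"
  obtains r c where "r < 2 * n" "c < 2 * n"
    "\<And>a. diag_entry n (H_comb n a) r - diag_entry n (H_comb n a) c = a j"
proof (cases "j < n")
  case True
  show ?thesis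
  proof (rule that[of "j - 1" j])
    fix a
    have "j - Suc 0 < n" using True by arith
    then show "diag_entry n (H_comb n a) (j - 1) - diag_entry n (H_comb n a) j = a j"
      using True j H_comb_diff[of j n a] by (simp add: diag_entry_def)
  qed (use True in auto)
next
  case False
  then have "j = n" "n \<ge> 1" using j by auto
  show ?thesis
  proof (rule that[of "n - 1" "2 * n - 1"])
    fix a
    have "2 * n - Suc 0 - n = n - Suc 0" "\<not> 2 * n - Suc 0 < n" using \<open>n \<ge> 1\<close> by arith+
    then show "diag_entry n (H_comb n a) (n - 1) - diag_entry n (H_comb n a) (2 * n - 1) = a j"
      using \<open>j = n\<close> \<open>n \<ge> 1\<close> H_comb_last[of n a] by (simp add: diag_entry_def)
  qed (use \<open>n \<ge> 1\<close> in auto)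
qed

text \<open>If the order holds, then the vector of the \<open>j\<close>-th simple root lies in the piece of index \<open>a\<^sub>j\<close> for the
  first element and therefore for the second. Conversely, decreasing the coordinates decreases the
  value of every positive root, and the values of negative roots are at most \<open>0\<close>, hence at
  most every index \<open>i \<ge> 0\<close>.\<close>

lemma preceq_H_comb_iff:
  assumes a: "\<forall>i\<in>{1..n}. H_comb n a i \<in> \<int>" "\<forall>j\<in>{1..n}. a j \<ge> 0"
    and b: "\<forall>i\<in>{1..n}. H_comb n b i \<in> \<int>" "\<forall>j\<in>{1..n}. b j \<ge> 0"
  shows "preceq (2 * n) (spC n) (torus_elem n (H_comb n a)) (torus_elem n (H_comb n b)) \<longleftrightarrow>
    (\<forall>j\<in>{1..n}. b j \<le> a j)"
proof
  assume le: "preceq (2 * n) (spC n) (torus_elem n (H_comb n a)) (torus_elem n (H_comb n b))"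
  show "\<forall>j\<in>{1..n}. b j \<le> a j"
  proof
    fix j assume j: "j \<in> {1..n}"
    obtain r c where rc: "r < 2 * n" "c < 2 * n"
      and val: "\<And>a. diag_entry n (H_comb n a) r - diag_entry n (H_comb n a) c = a j"
      using simple_root_position[OF j] by blast
    have "a j \<in> \<int>"
      using a(1) rc unfolding diag_entry_Ints_iff[symmetric] val[of a, symmetric] by simp
    then obtain i where i: "a j = of_int i" by (auto elim: Ints_cases)
    moreover have "a j \<ge> 0" using a(2) j by blast
    ultimately have "i \<ge> 0" by simp
    have "root_vector n r c \<in> parab (2 * n) (spC n) (torus_elem n (H_comb n a)) i"
      using i by (simp add: root_vector_in_parab_iff[OF a(1) rc] val)
    then have "root_vector n r c \<in> parab (2 * n) (spC n) (torus_elem n (H_comb n b)) i"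
      using le \<open>i \<ge> 0\<close> unfolding preceq_def by blast
    then show "b j \<le> a j"
      using i by (simp add: root_vector_in_parab_iff[OF b(1) rc] val)
  qed
next
  assume le: "\<forall>j\<in>{1..n}. b j \<le> a j"
  show "preceq (2 * n) (spC n) (torus_elem n (H_comb n a)) (torus_elem n (H_comb n b))"
    unfolding preceq_def
  proof (intro allI impI subsetI)
    fix i :: int and X
    assume "i \<ge> 0" and X: "X \<in> parab (2 * n) (spC n) (torus_elem n (H_comb n a)) i"
    have "diag_entry n (H_comb n b) r - diag_entry n (H_comb n b) c \<le> of_int i"
      if rc: "r < 2 * n" "c < 2 * n" and nz: "X $$ (r, c) \<noteq> 0" for r c
    proof -
      let ?d = "\<lambda>j. diag_entry n (H_coeff n j) r - diag_entry n (H_coeff n j) c"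
      have diff: "diag_entry n (H_comb n x) r - diag_entry n (H_comb n x) c = (\<Sum>j=1..n. x j * ?d j)" for x
        by (simp add: diag_entry_H_comb sum_subtractf right_diff_distrib)
      from diag_entry_H_coeff_comparable[OF rc] show ?thesis
      proof
        assume "\<forall>j\<in>{1..n}. diag_entry n (H_coeff n j) c \<le> diag_entry n (H_coeff n j) r"
        then have "(\<Sum>j=1..n. b j * ?d j) \<le> (\<Sum>j=1..n. a j * ?d j)"
          using le by (intro sum_mono mult_right_mono) auto
        also have "\<dots> \<le> of_int i"
          using X rc nz unfolding parab_torus_elem_iff[OF a(1)] diff[symmetric] by blast
        finally show ?thesis by (simp add: diff)
      next
        assume "\<forall>j\<in>{1..n}. diag_entry n (H_coeff n j) r \<le> diag_entry n (H_coeff n j) c"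
        then have "(\<Sum>j=1..n. b j * ?d j) \<le> 0"
          using b(2) by (intro sum_nonpos mult_nonneg_nonpos) auto
        also have "0 \<le> real_of_int i" using \<open>i \<ge> 0\<close> by simp
        finally show ?thesis by (simp add: diff)
      qed
    qed
    then show "X \<in> parab (2 * n) (spC n) (torus_elem n (H_comb n b)) i"
      using X unfolding parab_torus_elem_iff[OF a(1)] parab_torus_elem_iff[OF b(1)] by blast
  qed
qed

section \<open>The canonical element\<close>

text \<open>On the cones dominance is automatic, because the coordinates with respect to the \<open>E\<^sub>i\<close> are then
  nonnegative and weakly decreasing.\<close>

lemma pos_roots_H_comb_nonneg:
  assumes a: "\<forall>j\<in>{1..n}. a j \<ge> 0" and \<alpha>: "\<alpha> \<in> pos_roots n"
  shows "Re (\<alpha> (torus_elem n (H_comb n a)) / \<i>) \<ge> 0"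
proof -
  have nonneg: "H_comb n a i \<ge> 0" for i
    unfolding H_comb_def using a by (intro sum_nonneg mult_nonneg_nonneg) (auto simp: H_coeff_def)
  have mono: "H_comb n a j \<le> H_comb n a i" if "i \<le> j" for i j
    unfolding H_comb_def using a that by (intro sum_mono mult_left_mono) (auto simp: H_coeff_def)
  consider (plus) i j where "1 \<le> i" "i \<le> j" "j \<le> n" "\<alpha> = (\<lambda>\<xi>. L i \<xi> + L j \<xi>)"
    | (minus) i j where "1 \<le> i" "i < j" "j \<le> n" "\<alpha> = (\<lambda>\<xi>. L i \<xi> - L j \<xi>)"
    using \<alpha> unfolding pos_roots_def by blast
  then show ?thesis
  proof cases
    case plus
    then show ?thesis using nonneg[of i] nonneg[of j] by (simp add: L_torus_elem)
  next
    case minus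
    then show ?thesis using mono[of i j] by (simp add: L_torus_elem)
  qed
qed

lemma pos_lattice_cone_eq:
  "pos_lattice n \<inter> cone n I = {torus_elem n (H_comb n a) | a.
    (\<forall>j\<in>{1..n}. a j \<ge> 0 \<and> (a j = 0 \<longleftrightarrow> j \<notin> I)) \<and> (\<forall>i\<in>{1..n}. H_comb n a i \<in> \<int>)}"
proof -
  have "torus_elem n (H_comb n a) \<in> pos_lattice n \<longleftrightarrow> (\<forall>i\<in>{1..n}. H_comb n a i \<in> \<int>)"
    if "\<forall>j\<in>{1..n}. a j \<ge> 0 \<and> (a j = 0 \<longleftrightarrow> j \<notin> I)" for a
    unfolding pos_lattice_def using that pos_roots_H_comb_nonneg[of n a] torus_elem_in_int_lattice_iff[of n "H_comb n a"]
    by blast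
  then show ?thesis unfolding cone_eq by blast
qed

definition canonical_coeff :: "nat \<Rightarrow> nat set \<Rightarrow> nat \<Rightarrow> real" where
  "canonical_coeff n I j = (if j \<in> I then if j = n then 2 else 1 else 0)"

text \<open>Integrality of the coordinates with respect to the \<open>E\<^sub>i\<close> forces \<open>a\<^sub>j\<close> to be an integer for
  \<open>j < n\<close> and \<open>a\<^sub>n\<close> to be an even integer.\<close>

lemma canonical_coeff_least:
  assumes "\<forall>j\<in>{1..n}. a j \<ge> 0 \<and> (a j = 0 \<longleftrightarrow> j \<notin> I)" "\<forall>i\<in>{1..n}. H_comb n a i \<in> \<int>" "j \<in> {1..n}"
  shows "canonical_coeff n I j \<le> a j"
proof (cases "j \<in> I")
  case True
  then have pos: "a j > 0" using assms(1,3) by (metis less_eq_real_def)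
  show ?thesis
  proof (cases "j = n")
    case True
    have "H_comb n a n \<in> \<int>" using assms(2,3) True by blast
    then obtain k :: int where "H_comb n a n = of_int k" by (auto elim: Ints_cases)
    then have "a n = 2 * of_int k" using assms(3) True H_comb_last[of n a] by simp
    moreover from this have "k \<ge> 1" using pos True by simp
    ultimately show ?thesis using True by (simp add: canonical_coeff_def)
  next
    case False
    then have "j \<in> {1..<n}" "j \<in> {1..n}" "Suc j \<in> {1..n}" using assms(3) by auto
    then have "a j \<in> \<int>" using assms(2) H_comb_diff[of j n a] by (metis Ints_diff)
    then obtain k :: int where "a j = of_int k" by (auto elim: Ints_cases)
    moreover from this have "k \<ge> 1" using pos by simp
    ultimately show ?thesis using False by (simp add: canonical_coeff_def)
  qed
qed (use assms in \<open>auto simp: canonical_coeff_def\<close>)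

lemma H_comb_canonical_coeff:
  assumes I: "I \<subseteq> {1..n}" and i: "i \<in> {1..n}"
  shows "H_comb n (canonical_coeff n I) i = card (I \<inter> {i..n})"
proof -
  have "H_comb n (canonical_coeff n I) i = (\<Sum>j=1..n. if j \<in> I \<inter> {i..n} then 1 else 0)"
    unfolding H_comb_def using i by (intro sum.cong) (auto simp: canonical_coeff_def H_coeff_def)
  also have "\<dots> = (\<Sum>j\<in>{1..n} \<inter> (I \<inter> {i..n}). 1)"
    by (rule sum.inter_restrict[symmetric]) simp
  also have "{1..n} \<inter> (I \<inter> {i..n}) = I \<inter> {i..n}" using I by auto
  finally show ?thesis by simp
qed

definition canonical_elem :: "nat \<Rightarrow> nat set \<Rightarrow> complex mat" where
  "canonical_elem n I = torus_elem n (H_comb n (canonical_coeff n I))"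

lemma xi_sum_plus_delta:
  assumes n: "n \<ge> 1" and I: "I \<subseteq> {1..n}"
  shows "xi_sum n I + delta I n \<cdot>\<^sub>m H n n = canonical_elem n I"
proof -
  have "finite I" using I finite_subset by blast
  have xi: "xi_sum n I = torus_elem n (\<lambda>i. \<Sum>s\<in>I. H_coeff n s i)"
    unfolding xi_sum_def using I by (intro mat_sum_torus_elem H_eq_torus_elem) auto
  have "delta I n = complex_of_real (if n \<in> I then 1 else 0)"
    by (simp add: delta_def)
  then have de: "delta I n \<cdot>\<^sub>m H n n = torus_elem n (\<lambda>i. (if n \<in> I then 1 else 0) * H_coeff n n i)"
    using n by (simp only: H_eq_torus_elem smult_torus_elem atLeastAtMost_iff order_refl simp_thms)
  have "(\<Sum>s\<in>I. H_coeff n s i) + (if n \<in> I then 1 else 0) * H_coeff n n i =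
      H_comb n (canonical_coeff n I) i" for i
  proof -
    have "H_comb n (canonical_coeff n I) i =
        (\<Sum>j=1..n. (if j \<in> I then H_coeff n j i else 0) + (if j = n then (if n \<in> I then 1 else 0) * H_coeff n n i else 0))"
      unfolding H_comb_def by (intro sum.cong) (auto simp: canonical_coeff_def)
    also have "\<dots> = (\<Sum>j=1..n. if j \<in> I then H_coeff n j i else 0) + (if n \<in> I then 1 else 0) * H_coeff n n i"
      using n by (simp add: sum.distrib)
    also have "(\<Sum>j=1..n. if j \<in> I then H_coeff n j i else 0) = (\<Sum>j\<in>{1..n} \<inter> I. H_coeff n j i)"
      by (rule sum.inter_restrict[symmetric]) simp
    also have "{1..n} \<inter> I = I" using I by auto
    finally show ?thesis by simp
  qed
  then show ?thesis unfolding xi de add_torus_elem canonical_elem_def by simp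
qed

text \<open>By \<open>canonical_coeff_least\<close> the candidate lies above every element of its cone, so that it is
  maximal and every maximal element equals it.\<close>

lemma canonical_iff:
  assumes n: "n \<ge> 1" and I: "I \<subseteq> {1..n}"
  shows "canonical n I \<xi> \<longleftrightarrow> \<xi> = canonical_elem n I"
proof -
  let ?c = "canonical_coeff n I"
  let ?P = "\<lambda>a. (\<forall>j\<in>{1..n}. a j \<ge> 0 \<and> (a j = 0 \<longleftrightarrow> j \<notin> I)) \<and> (\<forall>i\<in>{1..n}. H_comb n a i \<in> \<int>)"
  have c: "?P ?c"
    using I by (simp add: H_comb_canonical_coeff) (simp add: canonical_coeff_def)
  have mem: "canonical_elem n I \<in> pos_lattice n \<inter> cone n I"
    unfolding pos_lattice_cone_eq canonical_elem_def using c by blast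
  have greatest: "preceq (2 * n) (spC n) \<xi> (canonical_elem n I)" if "\<xi> \<in> pos_lattice n \<inter> cone n I" for \<xi>
  proof -
    from that have "\<exists>a. \<xi> = torus_elem n (H_comb n a) \<and> ?P a"
      unfolding pos_lattice_cone_eq mem_Collect_eq .
    then obtain a where "\<xi> = torus_elem n (H_comb n a) \<and> ?P a" ..
    then have a: "\<xi> = torus_elem n (H_comb n a)" "?P a" by simp_all
    then show ?thesis
      unfolding a(1) canonical_elem_def using c canonical_coeff_least[of n a I]
      by (subst preceq_H_comb_iff) auto
  qed
  have antisym: "\<xi> = canonical_elem n I"
    if "\<xi> \<in> pos_lattice n \<inter> cone n I" "preceq (2 * n) (spC n) (canonical_elem n I) \<xi>" for \<xi>
  proof -
    from that(1) have "\<exists>a. \<xi> = torus_elem n (H_comb n a) \<and> ?P a"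
      unfolding pos_lattice_cone_eq mem_Collect_eq .
    then obtain a where "\<xi> = torus_elem n (H_comb n a) \<and> ?P a" ..
    then have a: "\<xi> = torus_elem n (H_comb n a)" "?P a" by simp_all
    have "\<forall>j\<in>{1..n}. a j \<le> ?c j"
      using that(2) a c unfolding a(1) canonical_elem_def by (subst (asm) preceq_H_comb_iff) auto
    then have "\<forall>j\<in>{1..n}. a j = ?c j"
      using canonical_coeff_least[of n a I] a(2) by (simp add: order_antisym)
    then have "H_comb n a = H_comb n ?c"
      by (simp add: H_comb_def fun_eq_iff)
    then show ?thesis by (simp add: a(1) canonical_elem_def)
  qed
  show ?thesis
    unfolding canonical_def using mem greatest antisym by metis
qed

section \<open>Weights are symmetric under negation\<close>

text \<open>The matrix \<open>\<Omega>\<close> of the linear map that agrees with \<open>J\<close> on the basis vectors. As \<open>\<Omega>\<^sup>2 = - 1\<close>, it is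
  also \<open>exp ((\<pi> / 2) \<Omega>)\<close>.\<close>

definition weyl_gen :: "nat \<Rightarrow> complex mat" where
  "weyl_gen n = mat (2 * n) (2 * n) (\<lambda>(r, c). if c = jconj n r then jsgn n r else 0)"

text \<open>For \<open>\<xi>\<close> in the torus \<open>[\<Omega>, [\<Omega>, \<xi>]] = - 4 \<xi>\<close>, so \<open>ad \<Omega>\<close> has the eigenvalues \<open>\<plusminus> 2 \<i>\<close> on the span of
  \<open>\<xi>\<close> and \<open>[\<Omega>, \<xi>]\<close>. For \<open>e = \<plusminus> 1\<close> the matrix below is the eigenvector
  \<open>\<xi> - (\<i> e / 2) [\<Omega>, \<xi>]\<close> for the eigenvalue \<open>2 \<i> e\<close>.\<close>

definition weyl_eigvec :: "nat \<Rightarrow> complex \<Rightarrow> (nat \<Rightarrow> real) \<Rightarrow> complex mat" where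
  "weyl_eigvec n e a = mat (2 * n) (2 * n) (\<lambda>(r, c). \<i> * complex_of_real (diag_entry n a r) *
     ((if c = r then 1 else 0) + e * \<i> * (if c = jconj n r then jsgn n r else 0)))"

lemma weyl_gen_carrier [simp]: "weyl_gen n \<in> carrier_mat (2 * n) (2 * n)"
  by (simp add: weyl_gen_def)

lemma weyl_eigvec_carrier [simp]: "weyl_eigvec n e a \<in> carrier_mat (2 * n) (2 * n)"
  by (simp add: weyl_eigvec_def)

lemma jconj_eq_iff: "r < 2 * n \<Longrightarrow> c < 2 * n \<Longrightarrow> jconj n c = r \<longleftrightarrow> c = jconj n r"
  using jconj_jconj by metis

lemma weyl_gen_in_spC: "weyl_gen n \<in> spC n"
  unfolding spC_iff
proof (intro conjI allI impI)
  fix r c assume rc: "r < 2 * n" "c < 2 * n"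
  show "weyl_gen n $$ (r, c) = - (jsgn n r * jsgn n c * weyl_gen n $$ (jconj n c, jconj n r))"
    using rc jconj_eq_iff[of c n r] by (auto simp: weyl_gen_def jconj_simps)
qed simp

lemma weyl_eigvec_in_spC: "weyl_eigvec n e a \<in> spC n"
  unfolding spC_iff
proof (intro conjI allI impI)
  fix r c assume rc: "r < 2 * n" "c < 2 * n"
  have 1: "jconj n r = jconj n c \<longleftrightarrow> c = r"
    using rc jconj_jconj by metis
  show "weyl_eigvec n e a $$ (r, c) = - (jsgn n r * jsgn n c * weyl_eigvec n e a $$ (jconj n c, jconj n r))"
  proof (cases "c = jconj n r")
    case True
    then show ?thesis
      using rc by (auto simp: weyl_eigvec_def jconj_simps)
  next
    case False
    then have "jconj n r \<noteq> jconj n (jconj n c)"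
      using rc by (metis jconj_jconj)
    then show ?thesis
      using rc False 1 by (auto simp: weyl_eigvec_def jconj_simps diag_entry_jconj)
  qed
qed simp

lemma bracket_weyl_gen:
  assumes e: "e * e = 1"
  shows "bracket (weyl_gen n) (weyl_eigvec n e a) = (2 * \<i> * e) \<cdot>\<^sub>m weyl_eigvec n e a"
proof (rule eq_matI)
  let ?O = "weyl_gen n" and ?P = "weyl_eigvec n e a"
  note dims = carrier_matD[OF weyl_gen_carrier[of n]] carrier_matD[OF weyl_eigvec_carrier[of n e a]]
  fix r c assume "r < dim_row ((2 * \<i> * e) \<cdot>\<^sub>m ?P)" "c < dim_col ((2 * \<i> * e) \<cdot>\<^sub>m ?P)"
  then have rc: "r < 2 * n" "c < 2 * n" using dims by auto
  let ?w = "\<i> * complex_of_real (diag_entry n a r)"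
  let ?d = "if c = r then 1 else 0 :: complex" and ?j = "if c = jconj n r then jsgn n r else 0"
  have P: "?P $$ (r, c) = ?w * (?d + e * \<i> * ?j)"
    using rc by (simp add: weyl_eigvec_def)
  have "(?O * ?P) $$ (r, c) = (\<Sum>s<2 * n. ?O $$ (r, s) * ?P $$ (s, c))"
    using rc by (intro index_mult_mat_sum) auto
  also have "\<dots> = (\<Sum>s<2 * n. if s = jconj n r then jsgn n r * ?P $$ (jconj n r, c) else 0)"
    using rc by (intro sum.cong) (auto simp: weyl_gen_def)
  also have "\<dots> = jsgn n r * ?P $$ (jconj n r, c)"
    using rc by (simp add: jconj_less)
  also have "?P $$ (jconj n r, c) =
      - ?w * ((if c = jconj n r then 1 else 0) + e * \<i> * (if c = r then - jsgn n r else 0))"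
    using rc by (simp add: weyl_eigvec_def jconj_less jconj_jconj jsgn_jconj diag_entry_jconj)
  also have "jsgn n r * \<dots> = ?w * (e * \<i> * ?d - ?j)"
    by (auto simp: jsgn_def algebra_simps)
  finally have 1: "(?O * ?P) $$ (r, c) = ?w * (e * \<i> * ?d - ?j)" .
  have "(?P * ?O) $$ (r, c) = (\<Sum>s<2 * n. ?P $$ (r, s) * ?O $$ (s, c))"
    using rc by (intro index_mult_mat_sum) auto
  also have "\<dots> = (\<Sum>s<2 * n. if s = jconj n c then ?P $$ (r, jconj n c) * jsgn n (jconj n c) else 0)"
    using rc jconj_eq_iff[of _ n c] by (intro sum.cong) (auto simp: weyl_gen_def jconj_simps)
  also have "\<dots> = ?P $$ (r, jconj n c) * jsgn n (jconj n c)"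
    using rc by (simp add: jconj_less)
  also have "\<dots> = ?w * (?j - e * \<i> * ?d)"
  proof -
    have a: "jconj n c = r \<longleftrightarrow> c = jconj n r" using jconj_eq_iff[OF rc] .
    have b: "jconj n c = jconj n r \<longleftrightarrow> c = r" using rc jconj_jconj by metis
    have "?P $$ (r, jconj n c) = ?w * ((if c = jconj n r then 1 else 0) + e * \<i> * (if c = r then jsgn n r else 0))"
      using rc by (simp add: weyl_eigvec_def jconj_less a b)
    moreover have "jsgn n (jconj n c) = jsgn n r" if "c = jconj n r"
      using that rc by (simp add: jconj_jconj)
    moreover have "jsgn n (jconj n c) = - jsgn n r" if "c = r"
      using that rc by (simp add: jsgn_jconj)
    moreover have "r \<noteq> jconj n r"
      using rc by (auto simp: jconj_def)
    ultimately show ?thesis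
      by (cases "c = r"; cases "c = jconj n r") (simp_all add: jsgn_square algebra_simps)
  qed
  finally have 2: "(?P * ?O) $$ (r, c) = ?w * (?j - e * \<i> * ?d)" .
  have "bracket ?O ?P $$ (r, c) = (?O * ?P) $$ (r, c) - (?P * ?O) $$ (r, c)"
    using dims rc by (simp add: bracket_def del: index_mult_mat(1))
  also have "\<dots> = 2 * (?w * (e * \<i> * ?d - ?j))"
    unfolding 1 2 by (simp add: algebra_simps)
  also have "\<dots> = 2 * \<i> * e * (?w * (?d + e * \<i> * ?j))"
  proof -
    have "\<i> * e * (e * \<i>) = - 1" using e by (simp add: mult_ac)
    then have "\<i> * e * (?d + e * \<i> * ?j) = e * \<i> * ?d - ?j"
      by (simp add: distrib_left mult.assoc[symmetric])
    from this[symmetric] show ?thesis by (simp only:) (simp only: mult_ac)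
  qed
  finally show "bracket ?O ?P $$ (r, c) = ((2 * \<i> * e) \<cdot>\<^sub>m ?P) $$ (r, c)"
    using rc dims P by simp
qed (use carrier_matD[OF bracket_carrier[OF weyl_gen_carrier[of n] weyl_eigvec_carrier[of n e a]]]
    carrier_matD[OF weyl_eigvec_carrier[of n e a]] in auto)

lemma torus_elem_eq_weyl_eigvecs:
  "torus_elem n a = (1 / 2) \<cdot>\<^sub>m (weyl_eigvec n 1 a + weyl_eigvec n (- 1) a)"
  by (rule eq_matI) (auto simp: torus_elem_def weyl_eigvec_def algebra_simps)

text \<open>Take \<open>g = exp ((\<pi> / 2) \<rho> \<Omega>)\<close>. Every \<open>\<xi>\<close> in the torus is a combination of two eigenvectors
  of \<open>ad \<Omega>\<close> with eigenvalues \<open>\<plusminus> 2 \<i>\<close>, and \<open>exp (\<plusminus> \<i> \<pi>) = - 1\<close>. The left inverse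
  \<open>g'\<close> ensures that \<open>g\<close> kills no weight vector.\<close>

lemma lie_rep_torus_anticommutes:
  assumes rep: "lie_rep (spC n) d \<rho>"
  obtains g g' where "g \<in> carrier_mat d d" "g' \<in> carrier_mat d d" "g' * g = 1\<^sub>m d"
    "\<And>\<xi>. \<xi> \<in> torus n \<Longrightarrow> \<rho> \<xi> * g = - (g * \<rho> \<xi>)"
proof -
  define A where "A = complex_of_real (pi / 2) \<cdot>\<^sub>m \<rho> (weyl_gen n)"
  have car: "\<rho> X \<in> carrier_mat d d" if "X \<in> spC n" for X
    using rep that by (simp add: lie_rep_def)
  have R: "\<rho> (weyl_gen n) \<in> carrier_mat d d" using car weyl_gen_in_spC by blast
  then have A: "A \<in> carrier_mat d d" by (simp add: A_def)
  have anti: "mat_exp A * \<rho> (weyl_eigvec n e a) = - 1 \<cdot>\<^sub>m (\<rho> (weyl_eigvec n e a) * mat_exp A)"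
    if e: "e = 1 \<or> e = - 1" for e a
  proof -
    let ?P = "weyl_eigvec n e a"
    have P: "\<rho> ?P \<in> carrier_mat d d" using car weyl_eigvec_in_spC by blast
    have "e * e = 1" using e by auto
    have "bracket (\<rho> (weyl_gen n)) (\<rho> ?P) = \<rho> (bracket (weyl_gen n) ?P)"
      using rep weyl_gen_in_spC weyl_eigvec_in_spC unfolding lie_rep_def by metis
    also have "\<dots> = (2 * \<i> * e) \<cdot>\<^sub>m \<rho> ?P"
      unfolding bracket_weyl_gen[OF \<open>e * e = 1\<close>] using rep weyl_eigvec_in_spC unfolding lie_rep_def by metis
    finally have br: "bracket (\<rho> (weyl_gen n)) (\<rho> ?P) = (2 * \<i> * e) \<cdot>\<^sub>m \<rho> ?P" .
    have "bracket A (\<rho> ?P) = complex_of_real (pi / 2) \<cdot>\<^sub>m bracket (\<rho> (weyl_gen n)) (\<rho> ?P)"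
      unfolding bracket_def A_def mult_smult_assoc_mat[OF R P] mult_smult_distrib[OF P R]
      using carrier_matD[OF R] carrier_matD[OF P] by (intro eq_matI) (auto simp: right_diff_distrib)
    also have "\<dots> = (\<i> * pi * e) \<cdot>\<^sub>m \<rho> ?P"
      unfolding br by (intro eq_matI) (auto simp: mult_ac)
    finally have "mat_exp A * \<rho> ?P = exp (\<i> * pi * e) \<cdot>\<^sub>m (\<rho> ?P * mat_exp A)"
      by (rule mat_exp_ad_eigenvector[OF A P])
    moreover have "exp (\<i> * pi * e) = - 1"
      using e by (auto simp: exp_minus mult.commute)
    ultimately show ?thesis by simp
  qed
  show ?thesis
  proof (rule that)
    show gA: "mat_exp A \<in> carrier_mat d d" using A by simp
    show "mat_exp (- A) \<in> carrier_mat d d" using A by simp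
    show "mat_exp (- A) * mat_exp A = 1\<^sub>m d" by (rule mat_exp_uminus_inverse(2)[OF A])
    fix \<xi> assume "\<xi> \<in> torus n"
    then obtain a where \<xi>: "\<xi> = torus_elem n a" by (auto simp: torus_eq)
    let ?P = "\<rho> (weyl_eigvec n 1 a)" and ?Q = "\<rho> (weyl_eigvec n (- 1) a)"
    have P: "?P \<in> carrier_mat d d" and Q: "?Q \<in> carrier_mat d d" using car weyl_eigvec_in_spC by auto
    have "weyl_eigvec n 1 a + weyl_eigvec n (- 1) a = 2 \<cdot>\<^sub>m torus_elem n a"
      unfolding torus_elem_eq_weyl_eigvecs by (intro eq_matI) auto
    then have sp: "weyl_eigvec n 1 a + weyl_eigvec n (- 1) a \<in> spC n"
      using smult_torus_elem[of 2 n a] torus_elem_in_spC by simp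
    have \<rho>: "\<rho> \<xi> = (1 / 2) \<cdot>\<^sub>m (?P + ?Q)"
      using rep sp weyl_eigvec_in_spC unfolding \<xi> torus_elem_eq_weyl_eigvecs lie_rep_def by simp
    have gP: "mat_exp A * ?P = - 1 \<cdot>\<^sub>m (?P * mat_exp A)" and gQ: "mat_exp A * ?Q = - 1 \<cdot>\<^sub>m (?Q * mat_exp A)"
      using anti by auto
    have "mat_exp A * \<rho> \<xi> = (1 / 2) \<cdot>\<^sub>m (mat_exp A * ?P + mat_exp A * ?Q)"
      unfolding \<rho> using mult_smult_distrib[OF gA add_carrier_mat[OF Q]] mult_add_distrib_mat[OF gA P Q] by simp
    moreover have "\<rho> \<xi> * mat_exp A = (1 / 2) \<cdot>\<^sub>m (?P * mat_exp A + ?Q * mat_exp A)"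
      unfolding \<rho> using mult_smult_assoc_mat[OF add_carrier_mat[OF Q] gA] add_mult_distrib_mat[OF P Q gA] by simp
    ultimately show "\<rho> \<xi> * mat_exp A = - (mat_exp A * \<rho> \<xi>)"
      using carrier_matD[OF P] carrier_matD[OF Q] carrier_matD[OF gA]
      by (simp only: gP gQ) (intro eq_matI; simp add: field_simps)
  qed
qed

text \<open>If \<open>v\<close> has weight \<open>\<omega>\<close>, then \<open>g v\<close> has weight \<open>- \<omega>\<close> for the invertible \<open>g\<close> that anticommutes
  with the torus.\<close>

lemma is_weight_uminus:
  assumes rep: "lie_rep (spC n) d \<rho>" and w: "is_weight n d \<rho> \<omega>"
  shows "is_weight n d \<rho> (restrict (\<lambda>\<xi>. - \<omega> \<xi>) (torus n))"
proof -
  obtain v where v: "v \<in> carrier_vec d" "v \<noteq> 0\<^sub>v d" "\<And>\<xi>. \<xi> \<in> torus n \<Longrightarrow> \<rho> \<xi> *\<^sub>v v = \<omega> \<xi> \<cdot>\<^sub>v v"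
    using w unfolding is_weight_def by blast
  obtain g g' where g: "g \<in> carrier_mat d d" "g' \<in> carrier_mat d d" "g' * g = 1\<^sub>m d"
    and anti: "\<And>\<xi>. \<xi> \<in> torus n \<Longrightarrow> \<rho> \<xi> * g = - (g * \<rho> \<xi>)"
    using lie_rep_torus_anticommutes[OF rep] by metis
  have gv: "g *\<^sub>v v \<in> carrier_vec d" using g(1) v(1) by simp
  have "g *\<^sub>v v \<noteq> 0\<^sub>v d"
  proof
    assume 0: "g *\<^sub>v v = 0\<^sub>v d"
    have "v = (g' * g) *\<^sub>v v" using v(1) g(3) by simp
    also have "\<dots> = g' *\<^sub>v (g *\<^sub>v v)" by (rule assoc_mult_mat_vec[OF g(2,1) v(1)])
    also have "\<dots> = 0\<^sub>v d" unfolding 0 using g(2) by (intro eq_vecI) auto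
    finally show False using v(2) by simp
  qed
  moreover have "\<rho> \<xi> *\<^sub>v (g *\<^sub>v v) = (- \<omega> \<xi>) \<cdot>\<^sub>v (g *\<^sub>v v)" if \<xi>: "\<xi> \<in> torus n" for \<xi>
  proof -
    have R: "\<rho> \<xi> \<in> carrier_mat d d"
      using rep \<xi> torus_subset_spC unfolding lie_rep_def by blast
    have "\<rho> \<xi> *\<^sub>v (g *\<^sub>v v) = (\<rho> \<xi> * g) *\<^sub>v v"
      by (rule assoc_mult_mat_vec[OF R g(1) v(1), symmetric])
    also have "\<dots> = - ((g * \<rho> \<xi>) *\<^sub>v v)"
      unfolding anti[OF \<xi>] using g(1) R v(1) by (intro eq_vecI) auto
    also have "(g * \<rho> \<xi>) *\<^sub>v v = g *\<^sub>v (\<omega> \<xi> \<cdot>\<^sub>v v)"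
      unfolding assoc_mult_mat_vec[OF g(1) R v(1)] v(3)[OF \<xi>] ..
    also have "\<dots> = \<omega> \<xi> \<cdot>\<^sub>v (g *\<^sub>v v)"
      by (rule mult_mat_vec[OF g(1) v(1)])
    also have "- (\<omega> \<xi> \<cdot>\<^sub>v (g *\<^sub>v v)) = (- \<omega> \<xi>) \<cdot>\<^sub>v (g *\<^sub>v v)"
      by (intro eq_vecI) auto
    finally show ?thesis .
  qed
  ultimately show ?thesis
    using gv unfolding is_weight_def by (auto intro!: bexI[of _ "g *\<^sub>v v"])
qed

text \<open>Evaluation at \<open>H\<^sub>j\<close> isolates the \<open>j\<close>-th coefficient of a combination of simple roots; two natural
  numbers that add up to zero vanish.\<close>

lemma weight_le_antisym:
  assumes "weight_le n \<mu> \<omega>" "weight_le n \<omega> \<mu>" "\<mu> \<in> extensional (torus n)" "\<omega> \<in> extensional (torus n)"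
  shows "\<mu> = \<omega>"
proof -
  obtain c c' :: "nat \<Rightarrow> nat" where c: "\<And>\<xi>. \<xi> \<in> torus n \<Longrightarrow> \<omega> \<xi> - \<mu> \<xi> = (\<Sum>i=1..n. of_nat (c i) * simple_root n i \<xi>)"
    and c': "\<And>\<xi>. \<xi> \<in> torus n \<Longrightarrow> \<mu> \<xi> - \<omega> \<xi> = (\<Sum>i=1..n. of_nat (c' i) * simple_root n i \<xi>)"
    using assms(1,2) unfolding weight_le_def by metis
  have at_H: "(\<Sum>i=1..n. of_nat (b i) * simple_root n i (H n j)) = of_nat (b j) * \<i>"
    if j: "j \<in> {1..n}" for b :: "nat \<Rightarrow> nat" and j
  proof -
    have "(\<Sum>i=1..n. of_nat (b i) * simple_root n i (H n j)) = (\<Sum>i=1..n. if i = j then of_nat (b j) * \<i> else 0)"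
      using j by (intro sum.cong) (auto simp: simple_root_H)
    then show ?thesis using j by simp
  qed
  have c0: "c j = 0" if j: "j \<in> {1..n}" for j
  proof -
    have H: "H n j \<in> torus n" using H_eq_torus_elem[OF j] by (simp add: torus_eq)
    have "of_nat (c j) * \<i> + of_nat (c' j) * \<i> = (0 :: complex)"
      using c[OF H] c'[OF H] unfolding at_H[OF j] by (metis add_diff_cancel_left' diff_add_cancel diff_diff_eq2 right_minus_eq)
    then have "of_nat (c j + c' j) * \<i> = (0 :: complex)" by (simp add: distrib_right)
    then show ?thesis by (simp flip: of_nat_add)
  qed
  show ?thesis
  proof (rule extensionalityI[OF assms(3,4)])
    fix \<xi> assume "\<xi> \<in> torus n"
    then have "\<omega> \<xi> - \<mu> \<xi> = 0" using c c0 by simp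
    then show "\<mu> \<xi> = \<omega> \<xi>" by simp
  qed
qed

text \<open>Negation permutes the weights and reverses their order.\<close>

lemma is_lowest_weight_uminus:
  assumes rep: "lie_rep (spC n) d \<rho>" and hw: "is_highest_weight n d \<rho> \<omega>"
  shows "is_lowest_weight n d \<rho> (restrict (\<lambda>\<xi>. - \<omega> \<xi>) (torus n))"
  unfolding is_lowest_weight_def
proof (intro conjI allI impI)
  show "is_weight n d \<rho> (restrict (\<lambda>\<xi>. - \<omega> \<xi>) (torus n))"
    using hw is_weight_uminus[OF rep] by (simp add: is_highest_weight_def)
  fix \<mu> assume "is_weight n d \<rho> \<mu>"
  then have "weight_le n (restrict (\<lambda>\<xi>. - \<mu> \<xi>) (torus n)) \<omega>"
    using hw is_weight_uminus[OF rep] by (simp add: is_highest_weight_def)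
  then show "weight_le n (restrict (\<lambda>\<xi>. - \<omega> \<xi>) (torus n)) \<mu>"
    unfolding weight_le_def by (simp add: add.commute)
qed

text \<open>Antisymmetry of the order on weights makes the highest and the lowest weight unique, so
  that the definite descriptions denote \<open>\<omega>\<close> and \<open>- \<omega>\<close>.\<close>

lemma r_num_eq:
  assumes rep: "lie_rep (spC n) d \<rho>" and hw: "is_highest_weight n d \<rho> \<omega>" and \<xi>: "\<xi> \<in> torus n"
  shows "r_num n d \<rho> \<xi> = 2 * \<omega> \<xi> / \<i>"
proof -
  let ?lw = "restrict (\<lambda>\<xi>. - \<omega> \<xi>) (torus n)"
  have ext: "\<mu> \<in> extensional (torus n)" if "is_weight n d \<rho> \<mu>" for \<mu>
    using that by (simp add: is_weight_def)
  have "(THE \<omega>. is_highest_weight n d \<rho> \<omega>) = \<omega>"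
    using hw ext by (intro the_equality weight_le_antisym) (auto simp: is_highest_weight_def)
  moreover have "(THE \<omega>. is_lowest_weight n d \<rho> \<omega>) = ?lw"
    using is_lowest_weight_uminus[OF rep hw] ext
    by (intro the_equality weight_le_antisym) (auto simp only: is_lowest_weight_def)
  ultimately show ?thesis
    using \<xi> by (simp add: r_num_def field_simps)
qed

lemma r_num_canonical_elem:
  assumes I: "I \<subseteq> {1..n}" and k: "k \<le> n" and rep: "lie_rep (spC n) d \<rho>"
    and hw: "is_highest_weight n d \<rho> (fundamental_weight n k)"
  shows "r_num n d \<rho> (canonical_elem n I) = of_nat (\<Sum>m=1..k. 2 * card (I \<inter> {m..n}))"
proof -
  have \<xi>: "canonical_elem n I \<in> torus n" by (simp add: canonical_elem_def torus_eq)
  have "L i (canonical_elem n I) = \<i> * of_nat (card (I \<inter> {i..n}))" if "i \<in> {1..k}" for i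
    using that k H_comb_canonical_coeff[OF I, of i] by (simp add: canonical_elem_def L_torus_elem)
  then have fw: "fundamental_weight n k (canonical_elem n I) = \<i> * of_nat (\<Sum>i=1..k. card (I \<inter> {i..n}))"
    using \<xi> by (simp add: fundamental_weight_def sum_distrib_left)
  have double: "(\<Sum>m=1..k. 2 * card (I \<inter> {m..n})) = 2 * (\<Sum>m=1..k. card (I \<inter> {m..n}))"
    by (rule sum_distrib_left[symmetric])
  have "2 * (\<i> * of_nat s) / \<i> = of_nat (2 * s)" for s :: nat
    by simp
  then show ?thesis
    by (simp only: r_num_eq[OF rep hw \<xi>] fw double)
qed

theorem theorem6p5:
  fixes n :: nat and I :: "nat set"
  assumes "n \<ge> 1" and "I \<subseteq> {1..n}"
  shows "canonical n I (xi_sum n I + delta I n \<cdot>\<^sub>m H n n) \<and>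
    (\<forall>\<xi>. canonical n I \<xi> \<longrightarrow> \<xi> = xi_sum n I + delta I n \<cdot>\<^sub>m H n n) \<and>
    (\<forall>k d \<rho>. 1 \<le> k \<and> k \<le> n \<and> irreducible_rep (spC n) d \<rho> \<and>
        is_highest_weight n d \<rho> (fundamental_weight n k) \<longrightarrow>
      r_num n d \<rho> (xi_sum n I + delta I n \<cdot>\<^sub>m H n n) =
        of_nat (\<Sum>m=1..k. 2 * card (I \<inter> {m..n})))"
  unfolding xi_sum_plus_delta[OF assms] canonical_iff[OF assms]
  using r_num_canonical_elem[OF assms(2)] by (auto simp: irreducible_rep_def)

end
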